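(* Let $n\ge 1$ and let $C_n$ be the quadrangulation of the polygon with $2n+2$ vertices whose inner edges are $(0,3),(0,5),\dots,(0,2n-1)$. Under the identification of quadrangulations of the red polygon with rooted ternary trees given by planar duality (rooted at the boundary edge $(r_{2n+1},r_0)$), the $C_n$-compatible quadrangulations are in bijection with rooted ternary trees (with $n$ nodes) with no middle branch, and therefore also with rooted binary trees (with $n$ nodes). Under this bijection, the oriented flips correspond to the left-to-right rotation moves of rooted binary trees; in-flips correspond to right branches and out-flips correspond to left branches.
   Context: Quadrangulations. Consider a regular polygon with $2n+2$ vertices ($n\ge 1$), numbered $0,\dots,2n+1$ clockwise (indices mod $2n+2$). A quadrangulation is a set of pairwise noncrossing diagonals cutting the polygon into quadrilaterals; there are then $n$ quadrilaterals, called squares, and $n-1$ diagonals, called inner edges. The $2n+2$ sides of the polygon are the boundary edges. Vertices are coloured alternately black and white; an edge (boundary or inner) always joins a white and a black vertex and is oriented from white to black. Compatibility. Fix a quadrangulation $Q$, drawn in a "blue" polygon with vertices $b_0,\dots,b_{2n+1}$. Let the "red" polygon, with vertices $r_0,\dots,r_{2n+1}$, be the blue one rotated clockwise by the angle $2\pi/(4n+4)$, so that the clockwise order on the circle is $b_0,r_0,b_1,r_1,\dots,b_{2n+1},r_{2n+1}$; $r_i$ has the same colour as $b_i$. A red edge is compatible with a blue edge if either they do not cross, or they cross and the pair (direction of the red edge, direction of the blue edge) is a positively oriented basis of the plane. A red edge is $Q$-compatible if it is compatible with all edges of $Q$. A $Q$-compatible quadrangulation is a quadrangulation $Q'$ of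 the red polygon all of whose edges are $Q$-compatible. (None of this depends on which of the two alternating colourings is chosen.) Flips. For a $Q$-compatible quadrangulation $Q'$ and an inner edge $i$ of $Q'$, there is exactly one other inner edge $j$ such that $(Q'\setminus\{i\})\cup\{j\}$ is a $Q$-compatible quadrangulation; replacing $i$ by $j$ is a flip. The flip takes place in the hexagon $H$ formed by the two squares of $Q'$ adjacent to $i$. There is always an inner edge of $Q$ (a long inner edge) that crosses two opposite sides of $H$, entering (for its white-to-black orientation) through one and leaving through the opposite one; all long inner edges enter through the same side and leave through the same side. Of the two $Q$-compatible diagonals of $H$, one, called (id), has its white endpoint on the side through which long inner edges enter $H$, and the other, called (op), has its white endpoint on the side through which they leave $H$. The flip is oriented from the quadrangulation containing (id) to the quadrangulation containing (op). An inner edge $i$ of $Q'$ is an out-flip of $Q'$ if flipping $i$ gives an oriented flip starting at $Q'$, and an in-flip of $Q'$ if flipping $i$ gives an oriented flip ending at $Q'$. Trees. The root is the boundary edge $(r_{2n+1},r_0)$ of the red polygon (the one corresponding to the blue vertex $b_0$). To a quadrangulation of the red polygon is associated a rooted ternary tree whose nodes are the squares: the root node is the square containing the root edge. For each square, the side facing the root (the root edge itself for the root node) is its entrance, and the other three sides, read clockwise along the square starting after the entrance, are called left, middle, right; when such a side is an inner edge, the square on its other side is the left, middle or right child, and the inner edge is a left, middle or right branch. Ternary trees with no middle branch are identified with rooted binary trees (each node has a possibly absent left child and a possibly absent right child). The left-to-right rotation at a node $v$ with left child $u$ replaces the subtree with root $v$, whose left subtree has root $u$ with subtrees $A$ (left)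 and $B$ (right), and whose right subtree is $C$, by the subtree with root $u$, left subtree $A$, and right subtree having root $v$ with left subtree $B$ and right subtree $C$. *)

theory Defs
  imports "HOL-Analysis.Analysis" "HOL-Library.Tree"
begin

text \<open>
  The polygon has vertices \<open>0, \<dots>, 2 n + 1\<close> in clockwise order; an unoriented edge is a
  two-element set of vertices. A polygon inscribed in it is given by its vertex set \<open>F\<close>; listing
  \<open>F\<close> increasingly is listing it clockwise, starting from its first vertex after the side
  \<open>(2 n + 1, 0)\<close>.
\<close>

definition side :: "nat set \<Rightarrow> nat \<Rightarrow> nat set" where
  "side F k = {sorted_list_of_set F ! k, sorted_list_of_set F ! (Suc k mod card F)}"

definition sides :: "nat set \<Rightarrow> nat set set" where
  "sides F = side F ` {..<card F}"

definition vertices :: "nat \<Rightarrow> nat set" where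
  "vertices n = {..<2 * n + 2}"

definition boundary_edges :: "nat \<Rightarrow> nat set set" where
  "boundary_edges n = sides (vertices n)"

definition diagonals :: "nat \<Rightarrow> nat set set" where
  "diagonals n = {{u, v} |u v. u \<in> vertices n \<and> v \<in> vertices n \<and> u \<noteq> v} - boundary_edges n"

definition blue :: "nat \<Rightarrow> nat \<Rightarrow> complex" where
  "blue n i = cis (- (2 * pi * real i / real (2 * n + 2)))"

definition red :: "nat \<Rightarrow> nat \<Rightarrow> complex" where
  "red n i = cis (- (2 * pi / real (4 * n + 4))) * blue n i"

text \<open>The embeddings \<open>P\<close> and \<open>Q\<close> place vertices in the plane (they will be \<^term>\<open>blue n\<close> or
  \<^term>\<open>red n\<close>). Edges that only share an endpoint do not cross.\<close>

definition cross :: "(nat \<Rightarrow> complex) \<Rightarrow> nat set \<Rightarrow> (nat \<Rightarrow> complex) \<Rightarrow> nat set \<Rightarrow> bool" where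
  "cross P e Q f \<longleftrightarrow> (\<exists>u v x y. e = {u, v} \<and> f = {x, y} \<and>
     open_segment (P u) (P v) \<inter> open_segment (Q x) (Q y) \<noteq> {})"

definition edges :: "nat \<Rightarrow> nat set set \<Rightarrow> nat set set" where
  "edges n D = boundary_edges n \<union> D"

text \<open>The regions into which a set \<open>D\<close> of pairwise noncrossing diagonals cuts the polygon, each
  given by its set of corners: all sides of a region are edges, and no edge joins two of its corners
  through its interior.\<close>

definition regions :: "nat \<Rightarrow> nat set set \<Rightarrow> nat set set" where
  "regions n D = {F. F \<subseteq> vertices n \<and> 3 \<le> card F \<and>
     (\<forall>u\<in>F. \<forall>v\<in>F. u \<noteq> v \<longrightarrow> ({u, v} \<in> edges n D \<longleftrightarrow> {u, v} \<in> sides F))}"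

text \<open>Crossings do not change under rotation, so it is immaterial that quadrangulations are defined
  through the blue polygon.\<close>

definition quadrangulation :: "nat \<Rightarrow> nat set set \<Rightarrow> bool" where
  "quadrangulation n D \<longleftrightarrow> D \<subseteq> diagonals n \<and>
     (\<forall>e\<in>D. \<forall>f\<in>D. e \<noteq> f \<longrightarrow> \<not> cross (blue n) e (blue n) f) \<and>
     (\<forall>F\<in>regions n D. card F = 4)"

definition squares :: "nat \<Rightarrow> nat set set \<Rightarrow> nat set set" where
  "squares n D = {F \<in> regions n D. card F = 4}"

definition fan :: "nat \<Rightarrow> nat set set" where
  "fan n = {{0, 2 * k + 1} |k. 1 \<le> k \<and> k \<le> n - 1}"

definition alternating_colouring :: "nat \<Rightarrow> (nat \<Rightarrow> bool) \<Rightarrow> bool" where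
  "alternating_colouring n white \<longleftrightarrow>
     (\<forall>i\<in>vertices n. white (Suc i mod (2 * n + 2)) \<longleftrightarrow> \<not> white i)"

text \<open>These are used only for edges joining a white and a black vertex, as all boundary edges and all
  edges of quadrangulations do.\<close>

definition white_end :: "(nat \<Rightarrow> bool) \<Rightarrow> nat set \<Rightarrow> nat" where
  "white_end white e = (THE v. v \<in> e \<and> white v)"

definition black_end :: "(nat \<Rightarrow> bool) \<Rightarrow> nat set \<Rightarrow> nat" where
  "black_end white e = (THE v. v \<in> e \<and> \<not> white v)"

definition direction :: "(nat \<Rightarrow> bool) \<Rightarrow> (nat \<Rightarrow> complex) \<Rightarrow> nat set \<Rightarrow> complex" where
  "direction white P e = P (black_end white e) - P (white_end white e)"

definition positive_basis :: "complex \<Rightarrow> complex \<Rightarrow> bool" where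
  "positive_basis u v \<longleftrightarrow> Re u * Im v - Im u * Re v > 0"

definition compatible_edges :: "nat \<Rightarrow> (nat \<Rightarrow> bool) \<Rightarrow> nat set \<Rightarrow> nat set \<Rightarrow> bool" where
  "compatible_edges n white r b \<longleftrightarrow> \<not> cross (red n) r (blue n) b \<or>
     positive_basis (direction white (red n) r) (direction white (blue n) b)"

definition compatible_quadrangulations ::
    "nat \<Rightarrow> (nat \<Rightarrow> bool) \<Rightarrow> nat set set \<Rightarrow> nat set set set" where
  "compatible_quadrangulations n white Q = {Q'. quadrangulation n Q' \<and>
     (\<forall>r\<in>edges n Q'. \<forall>b\<in>edges n Q. compatible_edges n white r b)}"

text \<open>The blue edge \<open>l\<close>, oriented from white to black, crosses the red edge \<open>s\<close> and afterwards the
  red edge \<open>s'\<close>.\<close>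

definition crosses_in_order ::
    "nat \<Rightarrow> (nat \<Rightarrow> bool) \<Rightarrow> nat set \<Rightarrow> nat set \<Rightarrow> nat set \<Rightarrow> bool" where
  "crosses_in_order n white l s s' \<longleftrightarrow> (\<exists>u v u' v' x y.
     s = {u, v} \<and> s' = {u', v'} \<and>
     x \<in> open_segment (blue n (white_end white l)) (blue n (black_end white l)) \<and>
     y \<in> open_segment (blue n (white_end white l)) (blue n (black_end white l)) \<and>
     x \<in> open_segment (red n u) (red n v) \<and>
     y \<in> open_segment (red n u') (red n v') \<and>
     x \<in> open_segment (blue n (white_end white l)) y)"

text \<open>The flip of \<open>Q1\<close> at its inner edge \<open>i\<close>, with result \<open>Q2\<close> in which \<open>i\<close> is replaced by \<open>j\<close>.\<close>

definition flip :: "nat \<Rightarrow> (nat \<Rightarrow> bool) \<Rightarrow> nat set set \<Rightarrow>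
    nat set \<Rightarrow> nat set \<Rightarrow> nat set set \<Rightarrow> nat set set \<Rightarrow> bool" where
  "flip n white Q i j Q1 Q2 \<longleftrightarrow>
     Q1 \<in> compatible_quadrangulations n white Q \<and> Q2 \<in> compatible_quadrangulations n white Q \<and>
     i \<in> Q1 \<and> j \<noteq> i \<and> Q2 = insert j (Q1 - {i})"

text \<open>The sides \<^term>\<open>side H k\<close> and \<^term>\<open>side H ((k + 3) mod 6)\<close> of the hexagon \<open>H = F \<union> G\<close> are
  opposite; \<open>l\<close> is a long inner edge entering through the former, which makes \<open>i\<close> the diagonal (id)
  and \<open>j\<close> the diagonal (op).\<close>

definition oriented_flip :: "nat \<Rightarrow> (nat \<Rightarrow> bool) \<Rightarrow> nat set set \<Rightarrow>
    nat set \<Rightarrow> nat set \<Rightarrow> nat set set \<Rightarrow> nat set set \<Rightarrow> bool" where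
  "oriented_flip n white Q i j Q1 Q2 \<longleftrightarrow> flip n white Q i j Q1 Q2 \<and>
     (\<exists>F\<in>squares n Q1. \<exists>G\<in>squares n Q1. F \<noteq> G \<and> i \<subseteq> F \<and> i \<subseteq> G \<and>
       (\<exists>l\<in>Q. \<exists>k<6.
          crosses_in_order n white l (side (F \<union> G) k) (side (F \<union> G) ((k + 3) mod 6)) \<and>
          white_end white i \<in> side (F \<union> G) k \<and>
          white_end white j \<in> side (F \<union> G) ((k + 3) mod 6)))"

definition out_flip ::
    "nat \<Rightarrow> (nat \<Rightarrow> bool) \<Rightarrow> nat set set \<Rightarrow> nat set set \<Rightarrow> nat set \<Rightarrow> bool" where
  "out_flip n white Q Q' i \<longleftrightarrow> (\<exists>j Q''. oriented_flip n white Q i j Q' Q'')"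

definition in_flip ::
    "nat \<Rightarrow> (nat \<Rightarrow> bool) \<Rightarrow> nat set set \<Rightarrow> nat set set \<Rightarrow> nat set \<Rightarrow> bool" where
  "in_flip n white Q Q' i \<longleftrightarrow> (\<exists>j Q''. oriented_flip n white Q j i Q'' Q')"

datatype 'a ttree = TLeaf | TNode 'a "'a ttree" "'a ttree" "'a ttree"

primrec nodes :: "'a ttree \<Rightarrow> nat" where
  "nodes TLeaf = 0"
| "nodes (TNode x l m r) = Suc (nodes l + nodes m + nodes r)"

primrec no_middle :: "'a ttree \<Rightarrow> bool" where
  "no_middle TLeaf \<longleftrightarrow> True"
| "no_middle (TNode x l m r) \<longleftrightarrow> m = TLeaf \<and> no_middle l \<and> no_middle r"

text \<open>An identification on the trees without middle branch only; middle subtrees are dropped.\<close>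

primrec to_binary :: "'a ttree \<Rightarrow> 'a tree" where
  "to_binary TLeaf = Leaf"
| "to_binary (TNode x l m r) = Node (to_binary l) x (to_binary r)"

text \<open>The root edge is \<open>{2 n + 1, 0}\<close>, so the side of a square \<open>F\<close> facing the root joins the greatest
  to the least vertex of \<open>F\<close>; the remaining sides follow clockwise.\<close>

definition root_edge :: "nat \<Rightarrow> nat set" where
  "root_edge n = {2 * n + 1, 0}"

definition entrance :: "nat set \<Rightarrow> nat set" where
  "entrance F = side F 3"

definition left_side :: "nat set \<Rightarrow> nat set" where
  "left_side F = side F 0"

definition middle_side :: "nat set \<Rightarrow> nat set" where
  "middle_side F = side F 1"

definition right_side :: "nat set \<Rightarrow> nat set" where
  "right_side F = side F 2"

lemma square_sides:
  assumes "F \<in> squares n D"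
  obtains a b c d where "a < b" "b < c" "c < d" "F = {a, b, c, d}"
    "left_side F = {a, b}" "middle_side F = {b, c}" "right_side F = {c, d}" "entrance F = {d, a}"
proof -
  have card: "card F = 4" and "F \<subseteq> {..<2 * n + 2}"
    using assms by (auto simp: squares_def regions_def vertices_def)
  then have fin: "finite F" using finite_subset by blast
  have "length (sorted_list_of_set F) = Suc (Suc (Suc (Suc 0)))" using card by simp
  then obtain a b c d where xs: "sorted_list_of_set F = [a, b, c, d]"
    unfolding length_Suc_conv by auto
  have F: "F = {a, b, c, d}"
    using set_sorted_list_of_set[OF fin] unfolding xs by simp
  have less: "a < b" "b < c" "c < d"
    using strict_sorted_list_of_set[of F] unfolding xs by simp_all
  show thesis
    by (rule that[OF less F]) (simp_all add: left_side_def middle_side_def right_side_def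
        entrance_def side_def xs card)
qed

text \<open>The tree of all squares lying behind the edge \<open>e\<close> as seen from the root. In a quadrangulation
  at most one square has \<open>e\<close> as its entrance, and none if \<open>e\<close> is a boundary edge other than the
  root edge. Every node is labelled by its square.\<close>

function dual_subtree :: "nat \<Rightarrow> nat set set \<Rightarrow> nat set \<Rightarrow> nat set ttree" where
  "dual_subtree n D e =
     (if \<exists>F\<in>squares n D. entrance F = e
      then let F = (SOME F. F \<in> squares n D \<and> entrance F = e)
        in TNode F (dual_subtree n D (left_side F)) (dual_subtree n D (middle_side F))
             (dual_subtree n D (right_side F))
      else TLeaf)"
  by pat_completeness auto

lemma dual_subtree_decreases:
  assumes "\<exists>F\<in>squares n D. entrance F = e"
    and "F = (SOME F. F \<in> squares n D \<and> entrance F = e)"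
  shows "Max (left_side F) - Min (left_side F) < Max e - Min e"
    and "Max (middle_side F) - Min (middle_side F) < Max e - Min e"
    and "Max (right_side F) - Min (right_side F) < Max e - Min e"
proof -
  have F: "F \<in> squares n D" "entrance F = e"
    using someI_ex[of "\<lambda>F. F \<in> squares n D \<and> entrance F = e"] assms by auto
  obtain a b c d where "a < b" "b < c" "c < d" "left_side F = {a, b}" "middle_side F = {b, c}"
      "right_side F = {c, d}" "e = {d, a}"
    using F by (elim square_sides) auto
  then show "Max (left_side F) - Min (left_side F) < Max e - Min e"
    and "Max (middle_side F) - Min (middle_side F) < Max e - Min e"
    and "Max (right_side F) - Min (right_side F) < Max e - Min e"
    by auto
qed

termination
  by (relation "Wellfounded.measure (\<lambda>(n, D, e). Max e - Min e)")
    (auto intro: dual_subtree_decreases)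

declare dual_subtree.simps [simp del]

definition dual_tree :: "nat \<Rightarrow> nat set set \<Rightarrow> nat set ttree" where
  "dual_tree n D = dual_subtree n D (root_edge n)"

definition binary_dual_tree :: "nat \<Rightarrow> nat set set \<Rightarrow> nat set tree" where
  "binary_dual_tree n D = to_binary (dual_tree n D)"

text \<open>Bare (unlabelled) trees are trees labelled by \<^typ>\<open>unit\<close>.\<close>

definition ternary_shape :: "'a ttree \<Rightarrow> unit ttree" where
  "ternary_shape = map_ttree (\<lambda>_. ())"

definition binary_shape :: "'a tree \<Rightarrow> unit tree" where
  "binary_shape = map_tree (\<lambda>_. ())"

definition left_branch :: "nat \<Rightarrow> nat set set \<Rightarrow> nat set \<Rightarrow> bool" where
  "left_branch n D i \<longleftrightarrow> i \<in> D \<and> (\<exists>F\<in>squares n D. i = left_side F)"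

definition right_branch :: "nat \<Rightarrow> nat set set \<Rightarrow> nat set \<Rightarrow> bool" where
  "right_branch n D i \<longleftrightarrow> i \<in> D \<and> (\<exists>F\<in>squares n D. i = right_side F)"

inductive rotation_at :: "'a \<Rightarrow> 'a tree \<Rightarrow> 'a tree \<Rightarrow> bool" for v :: 'a where
  here: "rotation_at v (Node (Node A u B) v C) (Node A u (Node B v C))"
| left: "rotation_at v l l' \<Longrightarrow> rotation_at v (Node l x r) (Node l' x r)"
| right: "rotation_at v r r' \<Longrightarrow> rotation_at v (Node l x r) (Node l x r')"

definition rotation :: "'a tree \<Rightarrow> 'a tree \<Rightarrow> bool" where
  "rotation t t' \<longleftrightarrow> (\<exists>v. rotation_at v t t')"

end

theory Submission
  imports Defs
begin

text \<open>
  Everything rests on one observation about parity. Write an edge as an arc \<open>(u, v)\<close> with \<open>u < v\<close>.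
  In a quadrangulation every arc joins vertices of different parity, and a red diagonal \<open>(u, v)\<close> is
  compatible with the fan exactly if \<open>u\<close> is even: a diagonal with \<open>u\<close> odd is crossed by the blue
  edge \<open>(0, u + 2)\<close> in the wrong direction, and for \<open>u\<close> even all crossings have the right one
  (\<open>compatible_quadrangulations_iff\<close>). So in a square \<open>a < b < c < d\<close> with \<open>a\<close> even, the middle
  side \<open>(b, c)\<close> starts at an odd vertex and hence is a boundary edge, \<open>c = b + 1\<close>. This is the
  absence of middle branches. Conversely, a binary tree placed at an even vertex prescribes, from the
  sizes of its subtrees, a set of arcs (\<open>tree_arcs\<close>), all of whose long members start at even
  vertices. Descending from the root edge shows that these sets are all the compatible quadrangulations
  (\<open>arcs_below_tree\<close>), and that the dual tree of such a set is the tree from which it was built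
  (\<open>dual_subtree_tree_diagonals\<close>).

  The definition of quadrangulations speaks of regions with arbitrarily many corners. It becomes
  local through two facts: above every long arc there is a region, formed by the vertices visible
  from that arc (\<open>region_above_arc\<close>), and if a square lies there, it is the only region
  (\<open>region_quad_unique\<close>).

  For flips, let \<open>p0 < \<dots> < p5\<close> be the hexagon formed by two adjacent squares; \<open>p0\<close> is even and the
  parities alternate. Of its three long diagonals, \<open>(p1, p4)\<close> starts at an odd vertex, so a flip can
  only exchange \<open>(p0, p3)\<close> and \<open>(p2, p5)\<close> (\<open>flip_in_hexagon\<close>). With \<open>(p0, p3)\<close> the square
  nearer to the root has the other one as its left child, with \<open>(p2, p5)\<close> as its right child, and
  passing from the former to the latter is the left-to-right rotation (\<open>hexagon_rotation_arcs\<close>). The orientation is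
  decided by the fan diagonals that cross the hexagon: they start at the vertex 0, which lies beyond the
  side \<open>(p5, p0)\<close>, and the only opposite pair of sides that they can pass through together consists of
  \<open>(p5, p0)\<close> and \<open>(p2, p3)\<close>. The diagonal \<open>(0, p2 + 1)\<close> does so. If the vertex 0 is white, it enters at
  \<open>(p5, p0)\<close>, which contains the white end \<open>p0\<close> of the first diagonal, and leaves at \<open>(p2, p3)\<close>, which
  contains the white end \<open>p2\<close> of the second; for the other colouring, both the direction and the white
  ends change (\<open>long_edge_passes_hexagon\<close>).
\<close>

section \<open>Chords of a circle\<close>

text \<open>Twice the signed area of the triangle \<open>p q r\<close>: positive if it is traversed counterclockwise. As a
  function of \<open>r\<close> it is affine and vanishes on the line through \<open>p\<close> and \<open>q\<close>, so its sign tells the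
  two sides of that line apart.\<close>

definition turn :: "complex \<Rightarrow> complex \<Rightarrow> complex \<Rightarrow> real" where
  "turn p q r = Re (q - p) * Im (r - p) - Im (q - p) * Re (r - p)"

text \<open>The vertices of both polygons lie on one regular polygon with \<open>4 n + 4\<close> vertices, the blue ones at
  the even and the red ones at the odd positions. All incidences below are read off from these
  positions, which increase clockwise.\<close>

definition circle_point :: "nat \<Rightarrow> nat \<Rightarrow> complex" where
  "circle_point n m = cis (- (2 * pi * real m / real (4 * n + 4)))"

lemma blue_circle_point: "blue n i = circle_point n (2 * i)"
proof -
  have "2 * pi * real i / real (2 * n + 2) = 2 * pi * real (2 * i) / real (4 * n + 4)"
    by (simp add: divide_simps)
  then show ?thesis by (simp only: blue_def circle_point_def)
qed

lemma red_circle_point: "red n i = circle_point n (2 * i + 1)"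
proof -
  have "- (2 * pi / real (4 * n + 4)) + - (2 * pi * real (2 * i) / real (4 * n + 4)) =
      - (2 * pi * real (2 * i + 1) / real (4 * n + 4))"
    by (simp add: divide_simps) (simp add: algebra_simps)
  then show ?thesis by (simp only: red_def blue_circle_point circle_point_def cis_mult)
qed

lemma turn_cis:
  "turn (cis \<alpha>) (cis \<beta>) (cis \<gamma>) =
     4 * sin ((\<beta> - \<alpha>) / 2) * sin ((\<gamma> - \<beta>) / 2) * sin ((\<gamma> - \<alpha>) / 2)"
proof -
  define x y where "x = (\<beta> - \<alpha>) / 2" and "y = (\<gamma> - \<beta>) / 2"
  have eq: "\<beta> - \<alpha> = 2 * x" "\<gamma> - \<beta> = 2 * y" "\<gamma> - \<alpha> = 2 * (x + y)"
    by (simp_all add: x_def y_def field_simps)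
  have "turn (cis \<alpha>) (cis \<beta>) (cis \<gamma>) = sin (\<beta> - \<alpha>) + sin (\<gamma> - \<beta>) - sin (\<gamma> - \<alpha>)"
    by (simp add: turn_def sin_diff algebra_simps)
  also have "\<dots> = sin (2 * x) + sin (2 * y) - sin (2 * x + 2 * y)"
    by (simp add: eq)
  also have "\<dots> = sin (2 * x) * (1 - cos (2 * y)) + sin (2 * y) * (1 - cos (2 * x))"
    by (simp only: sin_add) (simp add: algebra_simps)
  also have "\<dots> = 4 * sin x * sin y * sin (x + y)"
    by (simp only: sin_double cos_double_sin sin_add)
      (simp add: power2_eq_square algebra_simps)
  finally show ?thesis by (simp only: x_def y_def add_divide_distrib[symmetric]) simp
qed

text \<open>The three half-angles in \<open>turn_cis\<close> lie strictly between \<open>- \<pi>\<close> and 0, so all three sines are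
  negative.\<close>

lemma turn_circle_point_neg:
  assumes "k < l" "l < m" "m < k + (4 * n + 4)"
  shows "turn (circle_point n k) (circle_point n l) (circle_point n m) < 0"
proof -
  have sin_neg: "sin ((- (2 * pi * real j / real (4 * n + 4)) -
      - (2 * pi * real i / real (4 * n + 4))) / 2) < 0"
    if "i < j" "j < i + (4 * n + 4)" for i j
  proof -
    define x where "x = pi * (real j - real i) / real (4 * n + 4)"
    have "0 < x" using that by (simp add: x_def)
    have "real j - real i < real (4 * n + 4)" using that by linarith
    then have "(real j - real i) / real (4 * n + 4) < 1" by simp
    then have "pi * ((real j - real i) / real (4 * n + 4)) < pi * 1"
      by (rule mult_strict_left_mono) (rule pi_gt_zero)
    then have "x < pi" by (simp add: x_def)
    then have "0 < sin x" using \<open>0 < x\<close> by (rule sin_gt_zero[rotated])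
    moreover have "(- (2 * pi * real j / real (4 * n + 4)) -
      - (2 * pi * real i / real (4 * n + 4))) / 2 = - x"
      by (cases "real (4 * n + 4) = 0") (simp_all add: x_def field_simps del: of_nat_add of_nat_mult)
    ultimately show ?thesis by simp
  qed
  show ?thesis
    unfolding circle_point_def turn_cis
    using sin_neg[of k l] sin_neg[of l m] sin_neg[of k m] assms
    by (simp add: mult_less_0_iff zero_less_mult_iff)
qed

lemma turn_rotate: "turn q r p = turn p q r"
  and turn_swap: "turn p r q = - turn p q r"
  and turn_same: "turn p p q = 0" "turn p q p = 0" "turn q p p = 0"
  by (simp_all add: turn_def algebra_simps)

lemma turn_convex:
  "turn p q ((1 - s) *\<^sub>R x + s *\<^sub>R y) = (1 - s) * turn p q x + s * turn p q y"
  by (simp add: turn_def algebra_simps)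

lemma turn_on_segment:
  assumes "z \<in> open_segment p q"
  shows "turn p q z = 0"
proof -
  obtain s where "z = (1 - s) *\<^sub>R p + s *\<^sub>R q"
    using assms by (auto simp: in_segment)
  then show ?thesis by (simp add: turn_convex turn_same)
qed

text \<open>The point that divides \<open>r s\<close> in the ratio of the distances of \<open>r\<close> and \<open>s\<close> from the line \<open>p q\<close>, and
  the point that divides \<open>p q\<close> in the ratio of the distances from the line \<open>r s\<close>, coincide. This is a
  polynomial identity in the coordinates, because the two denominators are equal.\<close>

lemma segments_crossI:
  assumes "turn p q r < 0" "0 < turn p q s" "0 < turn r s p" "turn r s q < 0"
  shows "open_segment p q \<inter> open_segment r s \<noteq> {}"
proof -
  define \<alpha> \<beta> \<gamma> \<delta> where "\<alpha> = turn p q r" and "\<beta> = turn p q s"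
    and "\<gamma> = turn r s p" and "\<delta> = turn r s q"
  \<comment> \<open>The point of \<open>r s\<close> at which \<^term>\<open>turn p q\<close> vanishes.\<close>
  define z where "z = (1 - (- \<alpha>) / (\<beta> - \<alpha>)) *\<^sub>R r + ((- \<alpha>) / (\<beta> - \<alpha>)) *\<^sub>R s"
  have pos: "\<beta> - \<alpha> > 0" and sum: "\<gamma> - \<delta> = \<beta> - \<alpha>"
    using assms by (simp_all add: \<alpha>_def \<beta>_def \<gamma>_def \<delta>_def) (simp add: turn_def algebra_simps)
  have sign: "\<alpha> < 0" "0 < \<beta>" "0 < \<gamma>" "\<delta> < 0"
    using assms by (simp_all add: \<alpha>_def \<beta>_def \<gamma>_def \<delta>_def)
  have ne: "p \<noteq> q" "r \<noteq> s" using assms by (auto simp: turn_same)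
  have "0 < (- \<alpha>) / (\<beta> - \<alpha>)" by (rule divide_pos_pos) (use sign in auto)
  moreover have "(- \<alpha>) / (\<beta> - \<alpha>) < 1" by (subst divide_less_eq_1_pos[OF pos]) (use sign in simp)
  ultimately have "z \<in> open_segment r s"
    using ne unfolding in_segment z_def by blast
  have "(\<beta> - \<alpha>) *\<^sub>R z = \<beta> *\<^sub>R r + (- \<alpha>) *\<^sub>R s"
  proof -
    have "(\<beta> - \<alpha>) * ((- \<alpha>) / (\<beta> - \<alpha>)) = - \<alpha>" using pos by simp
    then have "(\<beta> - \<alpha>) * (1 - (- \<alpha>) / (\<beta> - \<alpha>)) = \<beta>" by (simp only: right_diff_distrib) simp
    with \<open>_ = - \<alpha>\<close> show ?thesis by (simp only: z_def scaleR_add_right scaleR_scaleR)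
  qed
  also have "\<dots> = (- \<delta>) *\<^sub>R p + \<gamma> *\<^sub>R q"
    by (rule complex_eqI) (simp_all add: \<alpha>_def \<beta>_def \<gamma>_def \<delta>_def turn_def algebra_simps)
  finally have "(\<beta> - \<alpha>) *\<^sub>R z = (- \<delta>) *\<^sub>R p + \<gamma> *\<^sub>R q" .
  then have "(1 / (\<beta> - \<alpha>)) *\<^sub>R ((\<beta> - \<alpha>) *\<^sub>R z) = (1 / (\<beta> - \<alpha>)) *\<^sub>R ((- \<delta>) *\<^sub>R p + \<gamma> *\<^sub>R q)"
    by simp
  then have "z = (- \<delta> / (\<beta> - \<alpha>)) *\<^sub>R p + (\<gamma> / (\<beta> - \<alpha>)) *\<^sub>R q"
    using pos by (simp add: scaleR_add_right scaleR_diff_right)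
  moreover have "- \<delta> / (\<beta> - \<alpha>) = 1 - \<gamma> / (\<beta> - \<alpha>)"
    using pos sum by (simp add: field_simps)
  moreover have "0 < \<gamma> / (\<beta> - \<alpha>)" "\<gamma> / (\<beta> - \<alpha>) < 1"
    using sign pos sum by (simp_all add: pos_divide_less_eq)
  ultimately have "z \<in> open_segment p q"
    using ne unfolding in_segment by metis
  with \<open>z \<in> open_segment r s\<close> show ?thesis by blast
qed

text \<open>The factor \<open>\<sigma>\<close> is a sign; it selects the side of the line \<open>p q\<close> on which the segment \<open>r s\<close> lies.
  At most one end of \<open>r s\<close> may be on the line, so no interior point is.\<close>

lemma segments_disjointI:
  assumes "0 \<le> \<sigma> * turn p q r" "0 \<le> \<sigma> * turn p q s" "\<sigma> * turn p q r \<noteq> 0 \<or> \<sigma> * turn p q s \<noteq> 0"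
  shows "open_segment p q \<inter> open_segment r s = {}"
proof (rule ccontr)
  assume "open_segment p q \<inter> open_segment r s \<noteq> {}"
  then obtain z where z: "z \<in> open_segment p q" "z \<in> open_segment r s" by blast
  then obtain t where t: "0 < t" "t < 1" "z = (1 - t) *\<^sub>R r + t *\<^sub>R s"
    by (auto simp: in_segment)
  have "(1 - t) * turn p q r + t * turn p q s = 0"
    using turn_on_segment[OF z(1)] unfolding t(3) turn_convex .
  moreover have "(1 - t) * (\<sigma> * turn p q r) + t * (\<sigma> * turn p q s) =
      \<sigma> * ((1 - t) * turn p q r + t * turn p q s)"
    by (simp add: algebra_simps)
  ultimately have "(1 - t) * (\<sigma> * turn p q r) + t * (\<sigma> * turn p q s) = 0" by simp
  moreover have "0 \<le> (1 - t) * (\<sigma> * turn p q r)" "0 \<le> t * (\<sigma> * turn p q s)"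
    using t assms(1,2) by simp_all
  ultimately have "(1 - t) * (\<sigma> * turn p q r) = 0" "t * (\<sigma> * turn p q s) = 0"
    by linarith+
  then show False using t assms(3) by simp
qed

abbreviation chord :: "nat \<Rightarrow> nat \<Rightarrow> nat \<Rightarrow> complex set" where
  "chord n a b \<equiv> open_segment (circle_point n a) (circle_point n b)"

text \<open>Two different chords cross if and only if their ends alternate on the circle. Chords with a common
  end count as not alternating.\<close>

lemma chords_cross_iff:
  assumes "a < b" "c < d" "b < 4 * n + 4" "d < 4 * n + 4" "(a, b) \<noteq> (c, d)"
  shows "chord n a b \<inter> chord n c d \<noteq> {} \<longleftrightarrow> a < c \<and> c < b \<and> b < d \<or> c < a \<and> a < d \<and> d < b"
proof -
  let ?T = "\<lambda>i j k. turn (circle_point n i) (circle_point n j) (circle_point n k)"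
  have neg: "?T i j k < 0" if "i < j" "j < k" "k < 4 * n + 4" for i j k
    using that by (intro turn_circle_point_neg) auto
  have pos: "0 < ?T i k j" if "i < j" "j < k" "k < 4 * n + 4" for i j k
    using neg[OF that] by (simp add: turn_swap[of _ "circle_point n k"])
  have before: "?T i j k < 0" if "k < i" "i < j" "j < 4 * n + 4" for i j k
    using neg[OF that] by (simp add: turn_rotate)
  have crossing: "chord n i j \<inter> chord n k l \<noteq> {}"
    if "i < k" "k < j" "j < l" "l < 4 * n + 4" for i j k l
    using segments_crossI[of "circle_point n k" "circle_point n l" "circle_point n i" "circle_point n j"]
      that neg pos before by (simp add: Int_commute)
  consider "a < c \<and> c < b \<and> b < d" | "c < a \<and> a < d \<and> d < b"
    | "b \<le> c" | "d \<le> a" | "a \<le> c \<and> d \<le> b" | "c \<le> a \<and> b \<le> d" by linarith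
  then show ?thesis
  proof cases
    case 1 then show ?thesis using crossing[of a c b d] assms by auto
  next
    case 2 then show ?thesis using crossing[of c a d b] assms by (auto simp: Int_commute)
  next
    case 3
    have "?T a b c \<le> 0"
      using neg[of a b c] assms 3 by (cases "b = c") (auto simp: turn_same)
    moreover have "?T a b d < 0" using neg[of a b d] assms 3 by auto
    ultimately have "chord n a b \<inter> chord n c d = {}"
      by (intro segments_disjointI[where \<sigma> = "-1"]) auto
    with 3 assms show ?thesis by auto
  next
    case 4
    have "?T a b d \<le> 0"
      using before[of d a b] assms 4 by (cases "d = a") (auto simp: turn_same)
    moreover have "?T a b c < 0" using before[of c a b] assms 4 by auto
    ultimately have "chord n a b \<inter> chord n c d = {}"
      by (intro segments_disjointI[where \<sigma> = "-1"]) auto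
    with 4 assms show ?thesis by auto
  next
    case 5
    have "0 \<le> ?T a b c" "a \<noteq> c \<Longrightarrow> 0 < ?T a b c"
      using pos[of a c b] assms 5 by (cases "a = c"; auto simp: turn_same)+
    moreover have "0 \<le> ?T a b d" "b \<noteq> d \<Longrightarrow> 0 < ?T a b d"
      using pos[of a d b] assms 5 by (cases "b = d"; auto simp: turn_same)+
    ultimately have "chord n a b \<inter> chord n c d = {}"
      using assms(5) by (intro segments_disjointI[where \<sigma> = 1]) auto
    with 5 assms show ?thesis by auto
  next
    case 6
    have "0 \<le> ?T c d a" "a \<noteq> c \<Longrightarrow> 0 < ?T c d a"
      using pos[of c a d] assms 6 by (cases "a = c"; auto simp: turn_same)+
    moreover have "0 \<le> ?T c d b" "b \<noteq> d \<Longrightarrow> 0 < ?T c d b"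
      using pos[of c b d] assms 6 by (cases "b = d"; auto simp: turn_same)+
    ultimately have "chord n c d \<inter> chord n a b = {}"
      using assms(5) by (intro segments_disjointI[where \<sigma> = 1]) auto
    with 6 assms show ?thesis by (auto simp: Int_commute)
  qed
qed

section \<open>Quadrangulations in terms of arcs\<close>

text \<open>This frees sides from the enumeration of \<open>F\<close>: two corners are joined by a side if no
  corner lies between them, or if all do (the closing side).\<close>

lemma sides_iff:
  assumes "finite F" "3 \<le> card F" "u \<in> F" "v \<in> F" "u < v"
  shows "{u, v} \<in> sides F \<longleftrightarrow> (\<forall>w\<in>F. w \<le> u \<or> v \<le> w) \<or> (\<forall>w\<in>F. u \<le> w \<and> w \<le> v)"
proof -
  define xs where "xs = sorted_list_of_set F"
  define N where "N = card F"
  have len: "length xs = N" and set: "set xs = F" and sorted: "sorted_wrt (<) xs"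
    using assms(1) by (simp_all add: xs_def N_def)
  have N: "3 \<le> N" using assms(2) by (simp add: N_def)
  obtain i where i: "i < N" "u = xs ! i"
    using assms(3) set len by (metis in_set_conv_nth)
  obtain j where j: "j < N" "v = xs ! j"
    using assms(4) set len by (metis in_set_conv_nth)
  have less: "xs ! k < xs ! l \<longleftrightarrow> k < l" if "k < N" "l < N" for k l
    using sorted_wrt_nth_less[OF sorted] that len
    by (metis linorder_neqE_nat order_less_asym order_less_irrefl)
  have le: "xs ! k \<le> xs ! l \<longleftrightarrow> k \<le> l" if "k < N" "l < N" for k l
    using less[OF that(2,1)] by (auto simp: not_less[symmetric])
  have eq: "xs ! k = xs ! l \<longleftrightarrow> k = l" if "k < N" "l < N" for k l
    using less[OF that] less[OF that(2,1)] by auto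
  have "i < j" using assms(5) less i j by simp
  have ball: "(\<forall>w\<in>F. P w) \<longleftrightarrow> (\<forall>k<N. P (xs ! k))" for P
    using set len by (metis in_set_conv_nth)
  have "{u, v} \<in> sides F \<longleftrightarrow> (\<exists>k<N. {xs ! i, xs ! j} = {xs ! k, xs ! (Suc k mod N)})"
    by (auto simp: sides_def side_def xs_def N_def i j)
  also have "\<dots> \<longleftrightarrow> (\<exists>k<N. i = k \<and> j = Suc k mod N \<or> j = k \<and> i = Suc k mod N)"
    using i(1) j(1) N by (intro ex_cong1 conj_cong refl) (auto simp: doubleton_eq_iff eq)
  also have "\<dots> \<longleftrightarrow> j = Suc i \<or> i = 0 \<and> j = N - 1"
  proof
    assume "\<exists>k<N. i = k \<and> j = Suc k mod N \<or> j = k \<and> i = Suc k mod N"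
    then obtain k where "k < N" "i = k \<and> j = Suc k mod N \<or> j = k \<and> i = Suc k mod N" by blast
    then show "j = Suc i \<or> i = 0 \<and> j = N - 1"
      using \<open>i < j\<close> by (cases "Suc k = N") auto
  next
    assume "j = Suc i \<or> i = 0 \<and> j = N - 1"
    then show "\<exists>k<N. i = k \<and> j = Suc k mod N \<or> j = k \<and> i = Suc k mod N"
      using i(1) j(1) N by (elim disjE) (auto intro: exI[of _ i] exI[of _ j])
  qed
  also have "j = Suc i \<longleftrightarrow> (\<forall>w\<in>F. w \<le> u \<or> v \<le> w)"
  proof -
    have "(\<forall>w\<in>F. w \<le> u \<or> v \<le> w) \<longleftrightarrow> (\<forall>k<N. k \<le> i \<or> j \<le> k)"
      unfolding ball i(2) j(2) using i(1) j(1) by (simp add: le)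
    also have "\<dots> \<longleftrightarrow> j = Suc i"
      using \<open>i < j\<close> j(1) by (auto dest: spec[of _ "Suc i"])
    finally show ?thesis by blast
  qed
  also have "i = 0 \<and> j = N - 1 \<longleftrightarrow> (\<forall>w\<in>F. u \<le> w \<and> w \<le> v)"
  proof -
    have "(\<forall>w\<in>F. u \<le> w \<and> w \<le> v) \<longleftrightarrow> (\<forall>k<N. i \<le> k \<and> k \<le> j)"
      unfolding ball i(2) j(2) using i(1) j(1) by (simp add: le)
    also have "\<dots> \<longleftrightarrow> i = 0 \<and> j = N - 1"
    proof
      assume A: "\<forall>k<N. i \<le> k \<and> k \<le> j"
      show "i = 0 \<and> j = N - 1"
        using A[rule_format, of 0] A[rule_format, of "N - 1"] j(1) N by auto
    qed auto
    finally show ?thesis by blast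
  qed
  finally show ?thesis .
qed

lemma boundary_edge_iff:
  assumes "n \<ge> 1" "u < v"
  shows "{u, v} \<in> boundary_edges n \<longleftrightarrow> v < 2 * n + 2 \<and> (v = Suc u \<or> u = 0 \<and> v = 2 * n + 1)"
proof (cases "v < 2 * n + 2")
  case True
  have "{u, v} \<in> boundary_edges n \<longleftrightarrow>
      (\<forall>w\<in>vertices n. w \<le> u \<or> v \<le> w) \<or> (\<forall>w\<in>vertices n. u \<le> w \<and> w \<le> v)"
    unfolding boundary_edges_def using assms True by (intro sides_iff) (auto simp: vertices_def)
  also have "(\<forall>w\<in>vertices n. w \<le> u \<or> v \<le> w) \<longleftrightarrow> v = Suc u"
    using assms(2) True by (auto simp: vertices_def dest: bspec[of _ _ "Suc u"])
  also have "(\<forall>w\<in>vertices n. u \<le> w \<and> w \<le> v) \<longleftrightarrow> u = 0 \<and> v = 2 * n + 1"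
    using True by (auto simp: vertices_def dest: bspec[of _ _ 0] bspec[of _ _ "2 * n + 1"])
  finally show ?thesis using True by simp
next
  case False
  have "sorted_list_of_set (vertices n) = [0..<2 * n + 2]"
    unfolding vertices_def lessThan_atLeast0 by (rule sorted_list_of_set_range)
  then have "\<Union> (boundary_edges n) \<subseteq> {..<2 * n + 2}"
    by (auto simp: boundary_edges_def sides_def side_def vertices_def simp del: upt_Suc)
  with False show ?thesis by auto
qed

text \<open>With ordered pairs, crossing becomes a chain of inequalities, and the difference of the two vertices is
  a length to which induction applies.\<close>

definition arcs :: "nat \<Rightarrow> nat set set \<Rightarrow> (nat \<times> nat) set" where
  "arcs n D = {(u, v). u < v \<and> {u, v} \<in> edges n D}"

definition noncrossing :: "(nat \<times> nat) set \<Rightarrow> bool" where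
  "noncrossing A \<longleftrightarrow> (\<forall>a b c d. (a, b) \<in> A \<longrightarrow> (c, d) \<in> A \<longrightarrow> \<not> (a < c \<and> c < b \<and> b < d))"

lemma noncrossingD:
  assumes "noncrossing A" "(a, b) \<in> A" "(c, d) \<in> A" "a < c" "c < b" "b < d"
  shows False
  using assms unfolding noncrossing_def by blast

text \<open>The square regions: what could still divide the square is one of its two diagonals.\<close>

definition quad :: "(nat \<times> nat) set \<Rightarrow> nat \<Rightarrow> nat \<Rightarrow> nat \<Rightarrow> nat \<Rightarrow> bool" where
  "quad A a b c d \<longleftrightarrow> a < b \<and> b < c \<and> c < d \<and> (a, b) \<in> A \<and> (b, c) \<in> A \<and> (c, d) \<in> A \<and> (a, d) \<in> A \<and>
     (a, c) \<notin> A \<and> (b, d) \<notin> A"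

lemma arc_edge: "(u, v) \<in> arcs n D \<Longrightarrow> {u, v} \<in> edges n D"
  by (simp add: arcs_def)

lemma arcs_iff:
  assumes "n \<ge> 1"
  shows "(u, v) \<in> arcs n D \<longleftrightarrow>
    u < v \<and> (v < 2 * n + 2 \<and> (v = Suc u \<or> u = 0 \<and> v = 2 * n + 1) \<or> {u, v} \<in> D)"
  using boundary_edge_iff[OF assms] by (auto simp: arcs_def edges_def)

lemma diagonal_iff:
  assumes "n \<ge> 1" "u < v"
  shows "{u, v} \<in> diagonals n \<longleftrightarrow> v < 2 * n + 2 \<and> v \<noteq> Suc u \<and> \<not> (u = 0 \<and> v = 2 * n + 1)"
proof -
  have "(\<exists>x y. {u, v} = {x, y} \<and> x \<in> vertices n \<and> y \<in> vertices n \<and> x \<noteq> y) \<longleftrightarrow> v < 2 * n + 2"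
  proof
    assume "v < 2 * n + 2"
    then show "\<exists>x y. {u, v} = {x, y} \<and> x \<in> vertices n \<and> y \<in> vertices n \<and> x \<noteq> y"
      using assms(2) by (intro exI[of _ u] exI[of _ v]) (simp add: vertices_def)
  qed (use assms(2) in \<open>auto simp: vertices_def doubleton_eq_iff\<close>)
  then show ?thesis using boundary_edge_iff[OF assms] by (auto simp: diagonals_def)
qed

lemma arcs_bounded:
  assumes "n \<ge> 1" "D \<subseteq> diagonals n" "(u, v) \<in> arcs n D"
  shows "u < v" "v < 2 * n + 2"
  using assms by (auto simp: arcs_iff diagonal_iff dest!: subsetD)

lemma diagonalE:
  assumes "e \<in> diagonals n"
  obtains u v where "u < v" "e = {u, v}"
proof -
  obtain u v where "e = {u, v}" "u \<noteq> v" using assms by (auto simp: diagonals_def)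
  then show thesis using that[of u v] that[of v u] by (cases "u < v") (auto simp: insert_commute)
qed

lemma regions_iff:
  "F \<in> regions n D \<longleftrightarrow> F \<subseteq> vertices n \<and> 3 \<le> card F \<and>
     (\<forall>u\<in>F. \<forall>v\<in>F. u < v \<longrightarrow>
        ((u, v) \<in> arcs n D \<longleftrightarrow> (\<forall>w\<in>F. w \<le> u \<or> v \<le> w) \<or> (\<forall>w\<in>F. u \<le> w \<and> w \<le> v)))"
proof (cases "F \<subseteq> vertices n \<and> 3 \<le> card F")
  case True
  then have "finite F" by (simp add: card_ge_0_finite)
  have "(\<forall>u\<in>F. \<forall>v\<in>F. u \<noteq> v \<longrightarrow> ({u, v} \<in> edges n D \<longleftrightarrow> {u, v} \<in> sides F)) \<longleftrightarrow>
      (\<forall>u\<in>F. \<forall>v\<in>F. u < v \<longrightarrow> ({u, v} \<in> edges n D \<longleftrightarrow> {u, v} \<in> sides F))"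
    by (metis insert_commute less_imp_neq linorder_neqE_nat)
  also have "\<dots> \<longleftrightarrow> (\<forall>u\<in>F. \<forall>v\<in>F. u < v \<longrightarrow>
        ((u, v) \<in> arcs n D \<longleftrightarrow> (\<forall>w\<in>F. w \<le> u \<or> v \<le> w) \<or> (\<forall>w\<in>F. u \<le> w \<and> w \<le> v)))"
    using True \<open>finite F\<close> by (auto simp: arcs_def sides_iff)
  finally show ?thesis using True by (simp add: regions_def)
qed (auto simp: regions_def)

lemma quad_region:
  assumes "quad (arcs n D) a b c d" "d < 2 * n + 2"
  shows "{a, b, c, d} \<in> regions n D"
proof -
  let ?A = "arcs n D" and ?F = "{a, b, c, d}"
  have less: "a < b" "b < c" "c < d" and A: "(a, b) \<in> ?A" "(b, c) \<in> ?A" "(c, d) \<in> ?A" "(a, d) \<in> ?A"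
    and notA: "(a, c) \<notin> ?A" "(b, d) \<notin> ?A"
    using assms(1) by (auto simp: quad_def)
  have "(u, v) \<in> ?A \<longleftrightarrow> (\<forall>w\<in>?F. w \<le> u \<or> v \<le> w) \<or> (\<forall>w\<in>?F. u \<le> w \<and> w \<le> v)"
    if uv: "u \<in> ?F" "v \<in> ?F" "u < v" for u v
  proof -
    consider "u = a" "v = b" | "u = a" "v = c" | "u = a" "v = d" | "u = b" "v = c"
      | "u = b" "v = d" | "u = c" "v = d"
      using uv less by auto
    then show ?thesis by cases (use less A notA in simp_all)
  qed
  moreover have "3 \<le> card ?F" "?F \<subseteq> vertices n" using less assms(2) by (auto simp: vertices_def)
  ultimately show ?thesis unfolding regions_iff by blast
qed

lemma gap_obtain:
  assumes "finite F" "a \<in> F" "d \<in> F" "a < x" "x < (d :: nat)" "x \<notin> F"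
  obtains p q where "p \<in> F" "q \<in> F" "p < x" "x < q" "\<forall>w\<in>F. w \<le> p \<or> q \<le> w"
proof -
  define L R where "L = {w \<in> F. w < x}" and "R = {w \<in> F. x < w}"
  have fin: "finite L" "finite R" and ne: "a \<in> L" "d \<in> R" using assms by (auto simp: L_def R_def)
  have "Max L \<in> L" "Min R \<in> R" using fin ne by (auto intro!: Max_in Min_in)
  moreover have "w \<le> Max L \<or> Min R \<le> w" if "w \<in> F" for w
  proof -
    have "w \<in> L \<or> w \<in> R" using that assms(6) by (cases w x rule: linorder_cases) (auto simp: L_def R_def)
    then show ?thesis using fin by auto
  qed
  ultimately show thesis using that[of "Max L" "Min R"] by (auto simp: L_def R_def)
qed

text \<open>Suppose that a corner of the square, say \<open>b\<close>, is missing in \<open>F\<close>. Then some side \<open>(p, q)\<close> of \<open>F\<close> jumps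
  over \<open>b\<close>. Since it crosses none of the sides of the square, it is a diagonal of the square or the arc
  \<open>(a, d)\<close>, and neither is possible. Once the four corners are in \<open>F\<close>, the sides of the square have
  to be sides of \<open>F\<close>, which leaves no room for further corners.\<close>

lemma region_quad_unique:
  assumes nc: "noncrossing (arcs n D)" and sq: "quad (arcs n D) a b c d"
    and F: "F \<in> regions n D" "a \<in> F" "d \<in> F" "\<forall>w\<in>F. a \<le> w \<and> w \<le> d"
  shows "F = {a, b, c, d}"
proof -
  let ?A = "arcs n D"
  have sub: "F \<subseteq> vertices n" and card: "3 \<le> card F" using F(1) by (auto simp: regions_iff)
  have fin: "finite F" using card by (simp add: card_ge_0_finite)
  have arc: "(u, v) \<in> ?A \<longleftrightarrow> (\<forall>w\<in>F. w \<le> u \<or> v \<le> w) \<or> (\<forall>w\<in>F. u \<le> w \<and> w \<le> v)"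
    if "u \<in> F" "v \<in> F" "u < v" for u v
    using F(1) that unfolding regions_iff by blast
  have less: "a < b" "b < c" "c < d" and A: "(a, b) \<in> ?A" "(b, c) \<in> ?A" "(c, d) \<in> ?A"
    and notA: "(a, c) \<notin> ?A" "(b, d) \<notin> ?A"
    using sq by (auto simp: quad_def)
  have not2: "\<not> (\<forall>w\<in>F. w \<le> a \<or> d \<le> w)"
  proof
    assume "\<forall>w\<in>F. w \<le> a \<or> d \<le> w"
    then have "F \<subseteq> {a, d}" using F(4) by force
    then have "card F \<le> card {a, d}" by (intro card_mono) auto
    also have "\<dots> \<le> 2" by (simp add: card_insert_if)
    finally show False using card by simp
  qed
  have b: "b \<in> F"
  proof (rule ccontr)
    assume "b \<notin> F"
    then obtain p q where pq: "p \<in> F" "q \<in> F" "p < b" "b < q" "\<forall>w\<in>F. w \<le> p \<or> q \<le> w"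
      using gap_obtain[OF fin F(2,3), of b] less by auto
    then have "(p, q) \<in> ?A" using arc[of p q] by simp
    have "p = a" using noncrossingD[OF nc A(1) \<open>(p, q) \<in> ?A\<close>] pq F(4) by fastforce
    have "c \<le> q" using noncrossingD[OF nc \<open>(p, q) \<in> ?A\<close> A(2)] pq by fastforce
    have "q = c \<or> q = d"
      using noncrossingD[OF nc \<open>(p, q) \<in> ?A\<close> A(3)] pq(2) F(4) \<open>c \<le> q\<close> \<open>p = a\<close> less by fastforce
    then show False using notA \<open>(p, q) \<in> ?A\<close> pq(5) not2 \<open>p = a\<close> by auto
  qed
  have c: "c \<in> F"
  proof (rule ccontr)
    assume "c \<notin> F"
    then obtain p q where pq: "p \<in> F" "q \<in> F" "p < c" "c < q" "\<forall>w\<in>F. w \<le> p \<or> q \<le> w"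
      using gap_obtain[OF fin F(2,3), of c] less by auto
    then have "(p, q) \<in> ?A" using arc[of p q] by simp
    have "b \<le> p" using pq b less by fastforce
    have "q = d" using noncrossingD[OF nc \<open>(p, q) \<in> ?A\<close> A(3)] pq F(4) by fastforce
    have "p = b" using noncrossingD[OF nc A(2) \<open>(p, q) \<in> ?A\<close>] pq \<open>b \<le> p\<close> by fastforce
    then show False using notA \<open>(p, q) \<in> ?A\<close> \<open>q = d\<close> by auto
  qed
  have "\<forall>w\<in>F. w \<le> a \<or> b \<le> w" using arc[OF F(2) b less(1)] A(1) F(3) less by force
  moreover have "\<forall>w\<in>F. w \<le> b \<or> c \<le> w" using arc[OF b c less(2)] A(2) F(3) less by force
  moreover have "\<forall>w\<in>F. w \<le> c \<or> d \<le> w" using arc[OF c F(3) less(3)] A(3) F(2) less by force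
  ultimately have "F \<subseteq> {a, b, c, d}" using F(4) by force
  then show ?thesis using b c F(2,3) by blast
qed

text \<open>The region consists of the vertices that are visible from the arc \<open>(a, d)\<close>, that is, not covered by
  another arc within \<open>{a..d}\<close>. Consecutive visible vertices \<open>u < v\<close> are joined by an arc: take the longest
  arc \<open>(u, y)\<close> with \<open>y \<le> v\<close>. If \<open>y < v\<close>, then \<open>y\<close> is covered by an arc, which has to start at \<open>u\<close>
  because it crosses nothing and does not cover \<open>u\<close>, contradicting the choice of \<open>y\<close>.\<close>

lemma region_above_arc:
  assumes n: "n \<ge> 1" and D: "D \<subseteq> diagonals n" and nc: "noncrossing (arcs n D)"
    and arc: "(a, d) \<in> arcs n D" "d \<noteq> Suc a"
  shows "\<exists>F\<in>regions n D. a \<in> F \<and> d \<in> F \<and> (\<forall>w\<in>F. a \<le> w \<and> w \<le> d)"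
proof -
  let ?A = "arcs n D"
  define covered where "covered v \<longleftrightarrow>
    (\<exists>x y. (x, y) \<in> ?A \<and> a \<le> x \<and> x < v \<and> v < y \<and> y \<le> d \<and> (x, y) \<noteq> (a, d))" for v
  define F where "F = {v. a \<le> v \<and> v \<le> d \<and> \<not> covered v}"
  have "a < d" "d < 2 * n + 2" using arcs_bounded[OF n D arc(1)] by auto
  have aF: "a \<in> F" and dF: "d \<in> F" and bounds: "\<forall>w\<in>F. a \<le> w \<and> w \<le> d"
    using \<open>a < d\<close> by (auto simp: F_def covered_def)
  have consecutive: "(u, v) \<in> ?A \<and> (u, v) \<noteq> (a, d)"
    if uv: "u \<in> F" "v \<in> F" "u < v" "\<forall>w\<in>F. w \<le> u \<or> v \<le> w" for u v
  proof -
    define Y where "Y = {y. (u, y) \<in> ?A \<and> y \<le> v \<and> (u, y) \<noteq> (a, d)}"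
    have "v \<le> d" using uv(2) bounds by auto
    have "finite Y" by (rule finite_subset[of _ "{..v}"]) (auto simp: Y_def)
    moreover have "Suc u \<in> Y"
      using uv(3) \<open>v \<le> d\<close> \<open>d < 2 * n + 2\<close> arc(2) by (auto simp: Y_def arcs_iff[OF n])
    ultimately have Y: "Max Y \<in> Y" and Y_max: "\<And>y. y \<in> Y \<Longrightarrow> y \<le> Max Y" by (auto intro: Max_in)
    define y where "y = Max Y"
    have y: "(u, y) \<in> ?A" "y \<le> v" "(u, y) \<noteq> (a, d)" using Y by (auto simp: Y_def y_def)
    have "u < y" using arcs_bounded[OF n D y(1)] by simp
    have "y = v"
    proof (rule ccontr)
      assume "y \<noteq> v"
      then have "y < v" using y(2) by simp
      then have "y \<notin> F" using uv(4) \<open>u < y\<close> by force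
      then have "covered y" using \<open>u < y\<close> \<open>y < v\<close> \<open>v \<le> d\<close> uv(1) by (auto simp: F_def)
      then obtain x' y' where xy: "(x', y') \<in> ?A" "a \<le> x'" "x' < y" "y < y'" "y' \<le> d" "(x', y') \<noteq> (a, d)"
        by (auto simp: covered_def)
      have "x' \<le> u" using noncrossingD[OF nc y(1) xy(1)] xy by force
      moreover have "\<not> covered u" "\<not> covered v" using uv by (auto simp: F_def)
      ultimately have "x' = u" using xy \<open>u < y\<close> unfolding covered_def by (metis le_neq_implies_less order_less_trans)
      then have "y' \<le> v" using \<open>\<not> covered v\<close> xy \<open>u < v\<close> unfolding covered_def by (metis not_less)
      then have "y' \<in> Y" using xy \<open>x' = u\<close> by (simp add: Y_def)
      then show False using Y_max[of y'] xy(4) by (simp add: y_def)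
    qed
    then show ?thesis using y by simp
  qed
  have "\<exists>w\<in>F. a < w \<and> w < d"
    using consecutive[OF aF dF \<open>a < d\<close>] by force
  then obtain w where w: "w \<in> F" "a < w" "w < d" by blast
  have fin: "finite F" by (rule finite_subset[of _ "{..d}"]) (auto simp: F_def)
  have "card {a, w, d} \<le> card F" using aF dF w fin by (intro card_mono) auto
  then have "3 \<le> card F" using w by (simp add: card_insert_if split: if_splits)
  moreover have "F \<subseteq> vertices n" using \<open>d < 2 * n + 2\<close> by (auto simp: F_def vertices_def)
  moreover have "(u, v) \<in> ?A \<longleftrightarrow> (\<forall>w\<in>F. w \<le> u \<or> v \<le> w) \<or> (\<forall>w\<in>F. u \<le> w \<and> w \<le> v)"
    if uv: "u \<in> F" "v \<in> F" "u < v" for u v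
  proof
    assume "(u, v) \<in> ?A"
    show "(\<forall>w\<in>F. w \<le> u \<or> v \<le> w) \<or> (\<forall>w\<in>F. u \<le> w \<and> w \<le> v)"
    proof (cases "(u, v) = (a, d)")
      case True
      then show ?thesis using bounds by auto
    next
      case False
      have "covered w" if "u < w" "w < v" for w
        unfolding covered_def using \<open>(u, v) \<in> ?A\<close> False that uv bounds by blast
      then have "\<not> (u < w \<and> w < v)" if "w \<in> F" for w using that by (auto simp: F_def)
      then show ?thesis by (auto simp: not_less)
    qed
  next
    assume "(\<forall>w\<in>F. w \<le> u \<or> v \<le> w) \<or> (\<forall>w\<in>F. u \<le> w \<and> w \<le> v)"
    then show "(u, v) \<in> ?A"
    proof
      assume "\<forall>w\<in>F. u \<le> w \<and> w \<le> v"
      then have "u \<le> a" "d \<le> v" using aF dF by auto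
      then have "u = a" "v = d" using bounds uv by (auto simp: order.eq_iff)
      then show ?thesis using arc by simp
    qed (use consecutive uv in blast)
  qed
  ultimately have "F \<in> regions n D" unfolding regions_iff by blast
  then show ?thesis using aF dF bounds by blast
qed

lemma squares_iff:
  assumes "n \<ge> 1" "D \<subseteq> diagonals n"
  shows "F \<in> squares n D \<longleftrightarrow> (\<exists>a b c d. quad (arcs n D) a b c d \<and> F = {a, b, c, d})"
proof
  assume F: "F \<in> squares n D"
  then obtain a b c d where less: "a < b" "b < c" "c < d" and eq: "F = {a, b, c, d}"
    by (elim square_sides) blast
  have "F \<in> regions n D" using F by (simp add: squares_def)
  then have arc: "(u, v) \<in> arcs n D \<longleftrightarrow> (\<forall>w\<in>F. w \<le> u \<or> v \<le> w) \<or> (\<forall>w\<in>F. u \<le> w \<and> w \<le> v)"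
    if "u \<in> F" "v \<in> F" "u < v" for u v
    using that unfolding regions_iff by blast
  have "quad (arcs n D) a b c d"
    unfolding quad_def using less
      arc[of a b] arc[of b c] arc[of c d] arc[of a d] arc[of a c] arc[of b d]
    by (simp add: eq)
  with eq show "\<exists>a b c d. quad (arcs n D) a b c d \<and> F = {a, b, c, d}" by blast
next
  assume "\<exists>a b c d. quad (arcs n D) a b c d \<and> F = {a, b, c, d}"
  then obtain a b c d where q: "quad (arcs n D) a b c d" "F = {a, b, c, d}" by blast
  have "d < 2 * n + 2" using q(1) arcs_bounded[OF assms, of a d] by (simp add: quad_def)
  then show "F \<in> squares n D" using quad_region[OF q(1)] q by (auto simp: squares_def quad_def)
qed

lemma cross_pair_iff:
  "cross P {u, v} Q {x, y} \<longleftrightarrow> open_segment (P u) (P v) \<inter> open_segment (Q x) (Q y) \<noteq> {}"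
  unfolding cross_def
proof
  assume "open_segment (P u) (P v) \<inter> open_segment (Q x) (Q y) \<noteq> {}"
  then show "\<exists>u' v' x' y'. {u, v} = {u', v'} \<and> {x, y} = {x', y'} \<and>
      open_segment (P u') (P v') \<inter> open_segment (Q x') (Q y') \<noteq> {}"
    by (intro exI[of _ u] exI[of _ v] exI[of _ x] exI[of _ y]) simp
qed (auto simp: doubleton_eq_iff open_segment_commute)

lemma blue_cross_iff:
  assumes "u < v" "x < y" "v < 2 * n + 2" "y < 2 * n + 2" "(u, v) \<noteq> (x, y)"
  shows "cross (blue n) {u, v} (blue n) {x, y} \<longleftrightarrow>
    u < x \<and> x < v \<and> v < y \<or> x < u \<and> u < y \<and> y < v"
  unfolding cross_pair_iff blue_circle_point using assms by (subst chords_cross_iff) auto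

lemma noncrossing_iff:
  assumes n: "n \<ge> 1" and D: "D \<subseteq> diagonals n"
  shows "(\<forall>e\<in>D. \<forall>f\<in>D. e \<noteq> f \<longrightarrow> \<not> cross (blue n) e (blue n) f) \<longleftrightarrow> noncrossing (arcs n D)"
proof
  assume L: "\<forall>e\<in>D. \<forall>f\<in>D. e \<noteq> f \<longrightarrow> \<not> cross (blue n) e (blue n) f"
  show "noncrossing (arcs n D)" unfolding noncrossing_def
  proof (intro allI impI notI)
    fix a b c d assume ab: "(a, b) \<in> arcs n D" and cd: "(c, d) \<in> arcs n D" and less: "a < c \<and> c < b \<and> b < d"
    have bounds: "a < b" "b < 2 * n + 2" "c < d" "d < 2 * n + 2"
      using arcs_bounded[OF n D ab] arcs_bounded[OF n D cd] by auto
    then have "{a, b} \<in> D" "{c, d} \<in> D" using ab cd less by (auto simp: arcs_iff[OF n])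
    moreover have "{a, b} \<noteq> {c, d}" using less by (auto simp: doubleton_eq_iff)
    ultimately have "\<not> cross (blue n) {a, b} (blue n) {c, d}"
      using L[THEN bspec, THEN bspec, THEN mp] by simp
    then show False using less bounds by (subst (asm) blue_cross_iff) auto
  qed
next
  assume R: "noncrossing (arcs n D)"
  show "\<forall>e\<in>D. \<forall>f\<in>D. e \<noteq> f \<longrightarrow> \<not> cross (blue n) e (blue n) f"
  proof (intro ballI impI)
    fix e f assume e: "e \<in> D" and f: "f \<in> D" and "e \<noteq> f"
    obtain u v where uv: "u < v" "e = {u, v}" using e D diagonalE by blast
    obtain x y where xy: "x < y" "f = {x, y}" using f D diagonalE by blast
    have A: "(u, v) \<in> arcs n D" "(x, y) \<in> arcs n D" using e f uv xy by (auto simp: arcs_iff[OF n])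
    show "\<not> cross (blue n) e (blue n) f"
      unfolding uv xy
      using \<open>e \<noteq> f\<close> uv xy arcs_bounded[OF n D A(1)] arcs_bounded[OF n D A(2)]
        noncrossingD[OF R A] noncrossingD[OF R A(2,1)]
      by (subst blue_cross_iff) auto
  qed
qed

text \<open>It suffices to look at the region just below each long arc, since every region is of that kind: its
  closing side is a long arc.\<close>

lemma quadrangulation_iff:
  assumes n: "n \<ge> 1"
  shows "quadrangulation n D \<longleftrightarrow> D \<subseteq> diagonals n \<and> noncrossing (arcs n D) \<and>
    (\<forall>a d. (a, d) \<in> arcs n D \<longrightarrow> d \<noteq> Suc a \<longrightarrow> (\<exists>b c. quad (arcs n D) a b c d))"
proof (cases "D \<subseteq> diagonals n \<and> noncrossing (arcs n D)")
  case True
  then have D: "D \<subseteq> diagonals n" and nc: "noncrossing (arcs n D)" by auto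
  have "(\<forall>F\<in>regions n D. card F = 4) \<longleftrightarrow>
    (\<forall>a d. (a, d) \<in> arcs n D \<longrightarrow> d \<noteq> Suc a \<longrightarrow> (\<exists>b c. quad (arcs n D) a b c d))"
  proof (intro iffI allI impI ballI)
    fix a d assume L: "\<forall>F\<in>regions n D. card F = 4" and ad: "(a, d) \<in> arcs n D" "d \<noteq> Suc a"
    obtain F where F: "F \<in> regions n D" "a \<in> F" "d \<in> F" "\<forall>w\<in>F. a \<le> w \<and> w \<le> d"
      using region_above_arc[OF n D nc ad] by blast
    have "F \<in> squares n D" using L F(1) by (simp add: squares_def)
    then obtain a' b c d' where q: "quad (arcs n D) a' b c d'" "F = {a', b, c, d'}"
      unfolding squares_iff[OF n D] by blast
    then have "a' = a" "d' = d" using F unfolding quad_def by force+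
    then show "\<exists>b c. quad (arcs n D) a b c d" using q by blast
  next
    fix F assume R: "\<forall>a d. (a, d) \<in> arcs n D \<longrightarrow> d \<noteq> Suc a \<longrightarrow> (\<exists>b c. quad (arcs n D) a b c d)"
      and F: "F \<in> regions n D"
    have card: "3 \<le> card F" using F by (simp add: regions_iff)
    then have fin: "finite F" and ne: "F \<noteq> {}" by (auto simp: card_ge_0_finite)
    define a d where "a = Min F" and "d = Max F"
    have ad: "a \<in> F" "d \<in> F" "\<forall>w\<in>F. a \<le> w \<and> w \<le> d" using fin ne by (auto simp: a_def d_def)
    have "\<not> d \<le> Suc a"
    proof
      assume "d \<le> Suc a"
      then have "F \<subseteq> {a, Suc a}" using ad by force
      then have "card F \<le> card {a, Suc a}" by (intro card_mono) auto
      then show False using card by simp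
    qed
    then have "(a, d) \<in> arcs n D" using F ad by (auto simp: regions_iff)
    then obtain b c where q: "quad (arcs n D) a b c d" using R \<open>\<not> d \<le> Suc a\<close> by fastforce
    have "F = {a, b, c, d}" by (rule region_quad_unique[OF nc q F ad])
    then show "card F = 4" using q by (auto simp: quad_def)
  qed
  then show ?thesis
    unfolding quadrangulation_def noncrossing_iff[OF n D] using D nc by (simp only: simp_thms)
next
  case False
  then show ?thesis unfolding quadrangulation_def using noncrossing_iff[OF n, of D] by blast
qed

lemma quad_unique:
  assumes n: "n \<ge> 1" and D: "D \<subseteq> diagonals n" and nc: "noncrossing (arcs n D)"
    and q: "quad (arcs n D) a b c d" and q': "quad (arcs n D) a b' c' d"
  shows "b' = b \<and> c' = c"
proof -
  have "(a, d) \<in> arcs n D" using q' by (simp add: quad_def)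
  from arcs_bounded[OF n D this] have "d < 2 * n + 2" by simp
  then have "{a, b', c', d} \<in> regions n D" using quad_region[OF q'] by simp
  then have "{a, b', c', d} = {a, b, c, d}"
    by (rule region_quad_unique[OF nc q]) (use q' in \<open>auto simp: quad_def\<close>)
  then have "b' \<in> {a, b, c, d}" "c' \<in> {a, b, c, d}" "b \<in> {a, b', c', d}" "c \<in> {a, b', c', d}"
    by auto
  then show ?thesis using q q' by (auto simp: quad_def)
qed

section \<open>Colours and compatibility with the fan\<close>

text \<open>Of two crossing chords, each directed from its first to its second end, the one that
  starts later in clockwise order, followed by the other, forms a positive basis.\<close>

lemma chords_positive_basis:
  assumes "a < c" "c < b" "b < d" "d < 4 * n + 4"
  shows "positive_basis (circle_point n d - circle_point n c) (circle_point n b - circle_point n a)"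
    and "\<not> positive_basis (circle_point n b - circle_point n a) (circle_point n d - circle_point n c)"
proof -
  let ?p = "circle_point n"
  have "turn (?p a) (?p b) (?p d) < 0" "turn (?p a) (?p c) (?p b) < 0"
    using assms by (auto intro!: turn_circle_point_neg)
  then have "turn (?p a) (?p b) (?p d) - turn (?p a) (?p b) (?p c) < 0"
    by (simp add: turn_swap[of _ "?p c" "?p b"])
  also have "turn (?p a) (?p b) (?p d) - turn (?p a) (?p b) (?p c) =
      Re (?p b - ?p a) * Im (?p d - ?p c) - Im (?p b - ?p a) * Re (?p d - ?p c)"
    by (simp add: turn_def algebra_simps)
  finally have neg: "Re (?p b - ?p a) * Im (?p d - ?p c) - Im (?p b - ?p a) * Re (?p d - ?p c) < 0" .
  then show "positive_basis (?p d - ?p c) (?p b - ?p a)"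
    unfolding positive_basis_def by (simp add: mult.commute)
  show "\<not> positive_basis (?p b - ?p a) (?p d - ?p c)"
    using neg unfolding positive_basis_def by linarith
qed

lemma positive_basis_minus:
  "positive_basis (- x) (- y) \<longleftrightarrow> positive_basis x y"
  "positive_basis (- x) y \<longleftrightarrow> positive_basis y x"
  "positive_basis x (- y) \<longleftrightarrow> positive_basis y x"
  by (auto simp: positive_basis_def algebra_simps)

lemma alternating_parity:
  assumes "alternating_colouring n white" "i < 2 * n + 2"
  shows "white i \<longleftrightarrow> (even i \<longleftrightarrow> white 0)"
  using assms(2)
proof (induction i)
  case (Suc i)
  have "white (Suc i mod (2 * n + 2)) \<longleftrightarrow> \<not> white i"
    using assms(1) Suc.prems unfolding alternating_colouring_def vertices_def
    by (elim bspec) simp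
  then show ?case using Suc by simp blast
qed simp

lemma white_end_pair: "white u \<noteq> white v \<Longrightarrow> white_end white {u, v} = (if white u then u else v)"
  and black_end_pair: "white u \<noteq> white v \<Longrightarrow> black_end white {u, v} = (if white u then v else u)"
  unfolding white_end_def black_end_def by (auto intro!: the_equality)

lemma red_blue_cross_iff:
  assumes "u < v" "x < y" "v < 2 * n + 2" "y < 2 * n + 2"
  shows "cross (red n) {u, v} (blue n) {x, y} \<longleftrightarrow>
    u < x \<and> x \<le> v \<and> v < y \<or> x \<le> u \<and> u < y \<and> y \<le> v"
proof -
  have ne: "(2 * u + 1, 2 * v + 1) \<noteq> (2 * x, 2 * y)" by simp presburger
  show ?thesis
    unfolding cross_pair_iff blue_circle_point red_circle_point
    by (subst chords_cross_iff[OF _ _ _ _ ne]; use assms in presburger)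
qed

text \<open>Both edges are directed from white to black, so reversing one of them exchanges the two cases of
  \<open>chords_positive_basis\<close>. Hence only the order of the smaller ends and whether they have the same
  colour matter.\<close>

lemma compatible_edges_iff:
  assumes alt: "alternating_colouring n white"
    and "u < v" "v < 2 * n + 2" "even u \<noteq> even v"
    and "x < y" "y < 2 * n + 2" "even x \<noteq> even y"
  shows "compatible_edges n white {u, v} {x, y} \<longleftrightarrow>
    \<not> (u < x \<and> x \<le> v \<and> v < y \<and> (even u \<longleftrightarrow> even x)) \<and>
    \<not> (x \<le> u \<and> u < y \<and> y \<le> v \<and> (even u \<longleftrightarrow> odd x))"
proof -
  have colour: "white w \<longleftrightarrow> (even w \<longleftrightarrow> white 0)" if "w < 2 * n + 2" for w
    using alternating_parity[OF alt that] .
  have ne: "white u \<noteq> white v" "white x \<noteq> white y"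
    using colour[of u] colour[of v] colour[of x] colour[of y] assms by auto
  have same: "(white u \<longleftrightarrow> white x) \<longleftrightarrow> (even u \<longleftrightarrow> even x)"
    using colour[of u] colour[of x] assms by auto
  define dr where "dr = direction white (red n) {u, v}"
  define db where "db = direction white (blue n) {x, y}"
  have dr: "dr = (if white u then red n v - red n u else - (red n v - red n u))"
    using ne by (simp add: dr_def direction_def white_end_pair black_end_pair)
  have db: "db = (if white x then blue n y - blue n x else - (blue n y - blue n x))"
    using ne by (simp add: db_def direction_def white_end_pair black_end_pair)
  have "positive_basis dr db \<longleftrightarrow> (even u \<longleftrightarrow> odd x)" if "u < x" "x \<le> v" "v < y"
  proof -
    have "positive_basis (blue n y - blue n x) (red n v - red n u)"
      "\<not> positive_basis (red n v - red n u) (blue n y - blue n x)"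
      unfolding blue_circle_point red_circle_point
      using that assms by (intro chords_positive_basis; simp)+
    then have "positive_basis dr db \<longleftrightarrow> \<not> (white u \<longleftrightarrow> white x)"
      unfolding dr db by (cases "white u"; cases "white x"; simp only: positive_basis_minus if_True if_False simp_thms)
    then show ?thesis using same by blast
  qed
  moreover have "positive_basis dr db \<longleftrightarrow> (even u \<longleftrightarrow> even x)" if "x \<le> u" "u < y" "y \<le> v"
  proof -
    have "positive_basis (red n v - red n u) (blue n y - blue n x)"
      "\<not> positive_basis (blue n y - blue n x) (red n v - red n u)"
      unfolding blue_circle_point red_circle_point
      using that assms by (intro chords_positive_basis; simp)+
    then have "positive_basis dr db \<longleftrightarrow> (white u \<longleftrightarrow> white x)"
      unfolding dr db by (cases "white u"; cases "white x"; simp only: positive_basis_minus if_True if_False simp_thms)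
    then show ?thesis using same by blast
  qed
  ultimately show ?thesis
    unfolding compatible_edges_def red_blue_cross_iff[OF assms(2,5,3,6)] dr_def db_def by auto
qed

lemma edgeE:
  assumes "n \<ge> 1" "D \<subseteq> diagonals n" "e \<in> edges n D"
  obtains u v where "(u, v) \<in> arcs n D" "e = {u, v}"
proof -
  have "\<exists>u v. u < v \<and> e = {u, v}"
  proof (cases "e \<in> D")
    case True
    then have "e \<in> diagonals n" using assms(2) by blast
    then show ?thesis by (rule diagonalE) blast
  next
    case False
    then obtain k where k: "k < 2 * n + 2" "e = side (vertices n) k"
      using assms(3) by (auto simp: edges_def boundary_edges_def sides_def vertices_def)
    have "sorted_list_of_set (vertices n) = [0..<2 * n + 2]"
      unfolding vertices_def lessThan_atLeast0 by (rule sorted_list_of_set_range)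
    then have e: "e = {k, Suc k mod (2 * n + 2)}"
      using k by (simp add: side_def vertices_def del: upt_Suc)
    show ?thesis
    proof (cases "Suc k = 2 * n + 2")
      case True
      then show ?thesis using e by (intro exI[of _ 0] exI[of _ k]) auto
    next
      case False
      then show ?thesis using e k by (intro exI[of _ k] exI[of _ "Suc k"]) auto
    qed
  qed
  then obtain u v where "u < v" "e = {u, v}" by blast
  then show thesis using that[of u v] assms(3) by (simp add: arcs_def)
qed

text \<open>A long arc closes a square whose other three sides are shorter, and a sum of three odd lengths is
  odd.\<close>

lemma quadrangulation_arc_parity:
  assumes n: "n \<ge> 1" and Q: "quadrangulation n D" and arc: "(u, v) \<in> arcs n D"
  shows "even u \<noteq> even v"
  using arc
proof (induction "v - u" arbitrary: u v rule: less_induct)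
  case less
  show ?case
  proof (cases "v = Suc u")
    case False
    then obtain b c where "quad (arcs n D) u b c v"
      using Q less.prems unfolding quadrangulation_iff[OF n] by blast
    then have *: "u < b" "b < c" "c < v" "(u, b) \<in> arcs n D" "(b, c) \<in> arcs n D" "(c, v) \<in> arcs n D"
      by (auto simp: quad_def)
    show ?thesis
      using less.hyps[OF _ *(4)] less.hyps[OF _ *(5)] less.hyps[OF _ *(6)] *(1-3) by auto
  qed simp
qed

lemma fan_diagonals: "n \<ge> 1 \<Longrightarrow> fan n \<subseteq> diagonals n"
  by (auto simp: fan_def diagonal_iff)

lemma arcs_fan:
  assumes "n \<ge> 1"
  shows "(x, y) \<in> arcs n (fan n) \<longleftrightarrow> x < y \<and> y < 2 * n + 2 \<and> (y = Suc x \<or> x = 0 \<and> odd y)"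
proof -
  have "{x, y} \<in> fan n \<longleftrightarrow> x = 0 \<and> odd y \<and> 3 \<le> y \<and> y < 2 * n + 1" if "x < y"
    using that by (auto simp: fan_def doubleton_eq_iff elim!: oddE)
  then show ?thesis unfolding arcs_iff[OF assms]
    by (cases "x < y") (auto elim: oddE)
qed

text \<open>A fan edge \<open>(0, y)\<close> crossing \<open>(u, v)\<close> requires \<open>u\<close> to be even, and for \<open>u\<close> odd the edge
  \<open>(0, u + 2)\<close> is such a fan edge unless \<open>v = u + 1\<close>. A boundary edge \<open>(x, x + 1)\<close> crosses only
  arcs that end in \<open>x\<close>, and these always in the right direction.\<close>

lemma compatible_quadrangulations_iff:
  assumes n: "n \<ge> 1" and alt: "alternating_colouring n white"
  shows "D \<in> compatible_quadrangulations n white (fan n) \<longleftrightarrow>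
    quadrangulation n D \<and> (\<forall>u v. (u, v) \<in> arcs n D \<longrightarrow> v = Suc u \<or> even u)"
proof (cases "quadrangulation n D")
  case True
  then have D: "D \<subseteq> diagonals n" by (simp add: quadrangulation_def)
  have "(\<forall>r\<in>edges n D. \<forall>b\<in>edges n (fan n). compatible_edges n white r b) \<longleftrightarrow>
    (\<forall>u v x y. (u, v) \<in> arcs n D \<longrightarrow> (x, y) \<in> arcs n (fan n) \<longrightarrow> compatible_edges n white {u, v} {x, y})"
  proof (intro iffI allI impI ballI)
    fix r b assume R: "\<forall>u v x y. (u, v) \<in> arcs n D \<longrightarrow> (x, y) \<in> arcs n (fan n) \<longrightarrow>
        compatible_edges n white {u, v} {x, y}"
      and r: "r \<in> edges n D" and b: "b \<in> edges n (fan n)"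
    obtain u v where "(u, v) \<in> arcs n D" "r = {u, v}" using edgeE[OF n D r] .
    moreover obtain x y where "(x, y) \<in> arcs n (fan n)" "b = {x, y}"
      using edgeE[OF n fan_diagonals[OF n] b] .
    ultimately show "compatible_edges n white r b" using R by simp
  qed (simp add: arc_edge)
  also have "\<dots> \<longleftrightarrow> (\<forall>u v. (u, v) \<in> arcs n D \<longrightarrow> v = Suc u \<or> even u)"
  proof (intro iffI allI impI)
    fix u v x y
    assume R: "\<forall>u v. (u, v) \<in> arcs n D \<longrightarrow> v = Suc u \<or> even u"
      and uv: "(u, v) \<in> arcs n D" and xy: "(x, y) \<in> arcs n (fan n)"
    have par: "even u \<noteq> even v" by (rule quadrangulation_arc_parity[OF n True uv])
    have xy': "x < y" "y < 2 * n + 2" "y = Suc x \<or> x = 0 \<and> odd y" using xy by (auto simp: arcs_fan[OF n])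
    then have "even x \<noteq> even y" by auto
    moreover have "v = Suc u \<or> even u" using R uv by blast
    ultimately show "compatible_edges n white {u, v} {x, y}"
      using compatible_edges_iff[OF alt, of u v x y] arcs_bounded[OF n D uv] par xy'
      by (auto simp: le_Suc_eq less_Suc_eq_le)
  next
    fix u v
    assume L: "\<forall>u v x y. (u, v) \<in> arcs n D \<longrightarrow> (x, y) \<in> arcs n (fan n) \<longrightarrow>
        compatible_edges n white {u, v} {x, y}"
      and uv: "(u, v) \<in> arcs n D"
    have par: "even u \<noteq> even v" by (rule quadrangulation_arc_parity[OF n True uv])
    note b = arcs_bounded[OF n D uv]
    show "v = Suc u \<or> even u"
    proof (rule ccontr)
      assume *: "\<not> (v = Suc u \<or> even u)"
      then have "odd u" "even v" "u + 2 \<le> v" using par b by auto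
      \<comment> \<open>As \<open>v\<close> is even, the shortest fan edge beyond \<open>u\<close> still ends before \<open>v\<close>.\<close>
      then have "(0, u + 2) \<in> arcs n (fan n)" using b by (simp add: arcs_fan[OF n])
      then have "compatible_edges n white {u, v} {0, u + 2}" using L uv by blast
      then show False
        using compatible_edges_iff[OF alt b par, of 0 "u + 2"] \<open>odd u\<close> \<open>u + 2 \<le> v\<close> b by auto
    qed
  qed
  finally show ?thesis using True by (simp add: compatible_quadrangulations_def)
qed (simp add: compatible_quadrangulations_def)

section \<open>Fan diagonals passing through a hexagon\<close>

text \<open>Along the segment from \<open>P\<close> to \<open>R\<close>, the affine function \<open>turn p q\<close> is negative at \<open>P\<close>, zero at \<open>X\<close> and
  positive at \<open>Y\<close>. So it increases, and the points occur in the order \<open>P, X, Y, R\<close>.\<close>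

lemma crossing_order:
  assumes X: "X \<in> open_segment P R" and Y: "Y \<in> open_segment P R"
    and "turn p q P < 0" "turn p q X = 0" "0 < turn p q Y"
  shows "X \<in> open_segment P Y" "Y \<in> open_segment R X"
    "X \<notin> open_segment R Y" "Y \<notin> open_segment P X"
proof -
  let ?f = "turn p q"
  obtain s where s: "0 < s" "s < 1" "X = (1 - s) *\<^sub>R P + s *\<^sub>R R" and "P \<noteq> R"
    using X by (auto simp: in_segment)
  obtain t where t: "0 < t" "t < 1" "Y = (1 - t) *\<^sub>R P + t *\<^sub>R R"
    using Y by (auto simp: in_segment)
  have fX: "s * (?f R - ?f P) = - ?f P" and fY: "t * (?f R - ?f P) > - ?f P"
    using assms(4,5) unfolding s(3) t(3) turn_convex by (simp_all add: algebra_simps)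
  have slope: "0 < ?f R - ?f P"
    using fX assms(3) s(1) by (metis neg_0_less_iff_less zero_less_mult_pos)
  have "s < t" using fX fY slope by (metis mult_less_cancel_right_pos)
  have "1 * (?f R - ?f P) > - ?f P"
    using mult_strict_right_mono[OF s(2) slope] fX by simp
  then have fR: "0 < ?f R" by simp
  show "X \<in> open_segment P Y"
  proof -
    have "X = (1 - s / t) *\<^sub>R P + (s / t) *\<^sub>R Y"
      unfolding s(3) t(3) scaleR_add_right using t(1)
      by (simp add: algebra_simps diff_divide_distrib scaleR_left_diff_distrib)
    moreover have "P \<noteq> Y" using assms by auto
    moreover have "0 < s / t" "s / t < 1" using s t \<open>s < t\<close> by auto
    ultimately show ?thesis unfolding in_segment by blast
  qed
  show "Y \<in> open_segment R X"
  proof -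
    define r where "r = (1 - t) / (1 - s)"
    have r: "0 < r" "r < 1" "r * (1 - s) = 1 - t" using s t \<open>s < t\<close> by (auto simp: r_def)
    then have "r * s = r - 1 + t" by (simp add: algebra_simps)
    then have "Y = (1 - r) *\<^sub>R R + r *\<^sub>R X"
      unfolding s(3) t(3) scaleR_add_right scaleR_scaleR r(3) \<open>r * s = _\<close>
      by (simp add: algebra_simps)
    moreover have "R \<noteq> X" using fR assms by auto
    ultimately show ?thesis using r(1,2) unfolding in_segment by blast
  qed
  show "X \<notin> open_segment R Y"
  proof
    assume "X \<in> open_segment R Y"
    then obtain r where r: "0 < r" "r < 1" "X = (1 - r) *\<^sub>R R + r *\<^sub>R Y" by (auto simp: in_segment)
    have "0 < ?f X" unfolding r(3) turn_convex using r fR assms(5) by (simp add: add_pos_pos)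
    then show False using assms by simp
  qed
  show "Y \<notin> open_segment P X"
  proof
    assume "Y \<in> open_segment P X"
    then obtain r where r: "0 < r" "r < 1" "Y = (1 - r) *\<^sub>R P + r *\<^sub>R X" by (auto simp: in_segment)
    have "?f Y < 0" unfolding r(3) turn_convex using r assms(3,4) by (simp add: mult_pos_neg)
    then show False using assms by simp
  qed
qed

text \<open>The chord from \<open>a\<close> to \<open>e\<close> separates the position 0 from the chord from \<open>c\<close> to \<open>d\<close>, so a chord
  starting at 0 meets it first.\<close>

lemma nested_chords_crossing_order:
  assumes less: "0 < a" "a < c" "c < d" "d < e" "e < 4 * n + 4"
    and X: "X \<in> chord n 0 m" "X \<in> chord n a e" and Y: "Y \<in> chord n 0 m" "Y \<in> chord n c d"
  shows "X \<in> open_segment (circle_point n 0) Y" "Y \<in> open_segment (circle_point n m) X"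
    "X \<notin> open_segment (circle_point n m) Y" "Y \<notin> open_segment (circle_point n 0) X"
proof -
  let ?f = "turn (circle_point n a) (circle_point n e)"
  have f0: "?f (circle_point n 0) < 0"
    using turn_circle_point_neg[of 0 a e n] less by (simp add: turn_rotate)
  have "?f (circle_point n i) > 0" if "a < i" "i < e" for i
    using turn_circle_point_neg[of a i e n] that less by (simp add: turn_swap[of _ "circle_point n e"])
  then have f: "?f (circle_point n c) > 0" "?f (circle_point n d) > 0" using less by auto
  obtain t where t: "0 < t" "t < 1" "Y = (1 - t) *\<^sub>R circle_point n c + t *\<^sub>R circle_point n d"
    using Y(2) by (auto simp: in_segment)
  have fY: "0 < ?f Y" unfolding t(3) turn_convex using t f by (simp add: add_pos_pos)
  have fX: "?f X = 0" using turn_on_segment[OF X(2)] .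
  show "X \<in> open_segment (circle_point n 0) Y" "Y \<in> open_segment (circle_point n m) X"
    "X \<notin> open_segment (circle_point n m) Y" "Y \<notin> open_segment (circle_point n 0) X"
    using crossing_order[OF X(1) Y(1) f0 fX fY] by auto
qed

lemma hexagon_sides:
  assumes "p0 < p1" "p1 < p2" "p2 < p3" "p3 < p4" "p4 < (p5 :: nat)"
  defines "H \<equiv> {p0, p1, p2, p3, p4, p5}"
  shows "side H 0 = {p0, p1}" "side H 1 = {p1, p2}" "side H 2 = {p2, p3}"
    "side H 3 = {p3, p4}" "side H 4 = {p4, p5}" "side H 5 = {p5, p0}"
proof -
  have "sorted_list_of_set H = [p0, p1, p2, p3, p4, p5]"
    unfolding H_def using assms(1-5) by (intro sorted_list_of_set.sorted_key_list_of_set_unique[THEN iffD1, simplified]) auto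
  moreover have "card H = 6" unfolding H_def using assms(1-5) by simp
  ultimately show "side H 0 = {p0, p1}" "side H 1 = {p1, p2}" "side H 2 = {p2, p3}"
    "side H 3 = {p3, p4}" "side H 4 = {p4, p5}" "side H 5 = {p5, p0}"
    by (simp_all add: side_def)
qed

text \<open>The condition by which oriented flips single out \<open>i\<close> as (id) and \<open>j\<close> as (op) in the hexagon \<open>H\<close>.\<close>

definition long_edge_passes ::
    "nat \<Rightarrow> (nat \<Rightarrow> bool) \<Rightarrow> nat set \<Rightarrow> nat set \<Rightarrow> nat set \<Rightarrow> bool" where
  "long_edge_passes n white H i j \<longleftrightarrow> (\<exists>l\<in>fan n. \<exists>k<6.
     crosses_in_order n white l (side H k) (side H ((k + 3) mod 6)) \<and>
     white_end white i \<in> side H k \<and> white_end white j \<in> side H ((k + 3) mod 6))"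

text \<open>The corners of two adjacent squares of a compatible quadrangulation. Parity makes the two ends of the
  diagonals distinguishable: the even one is white if and only if the vertex 0 is.\<close>

definition hexagon :: "nat \<Rightarrow> nat \<Rightarrow> nat \<Rightarrow> nat \<Rightarrow> nat \<Rightarrow> nat \<Rightarrow> nat \<Rightarrow> bool" where
  "hexagon n p0 p1 p2 p3 p4 p5 \<longleftrightarrow> p0 < p1 \<and> p1 < p2 \<and> p2 < p3 \<and> p3 < p4 \<and> p4 < p5 \<and> p5 < 2 * n + 2 \<and>
     even p0 \<and> odd p1 \<and> even p2 \<and> odd p3 \<and> even p4 \<and> odd p5"

lemma crosses_in_order_pair:
  "crosses_in_order n white l {u, v} {u', v'} \<longleftrightarrow> (\<exists>x y.
     x \<in> open_segment (blue n (white_end white l)) (blue n (black_end white l)) \<and>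
     y \<in> open_segment (blue n (white_end white l)) (blue n (black_end white l)) \<and>
     x \<in> open_segment (red n u) (red n v) \<and> y \<in> open_segment (red n u') (red n v') \<and>
     x \<in> open_segment (blue n (white_end white l)) y)" (is "_ = ?R")
proof
  assume "crosses_in_order n white l {u, v} {u', v'}"
  then obtain a b a' b' x y where eq: "{u, v} = {a, b}" "{u', v'} = {a', b'}"
    and x: "x \<in> open_segment (red n a) (red n b)" and y: "y \<in> open_segment (red n a') (red n b')"
    and xy: "x \<in> open_segment (blue n (white_end white l)) (blue n (black_end white l))"
      "y \<in> open_segment (blue n (white_end white l)) (blue n (black_end white l))"
      "x \<in> open_segment (blue n (white_end white l)) y"
    unfolding crosses_in_order_def by blast
  have "open_segment (red n a) (red n b) = open_segment (red n u) (red n v)"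
    "open_segment (red n a') (red n b') = open_segment (red n u') (red n v')"
    using eq by (auto simp: doubleton_eq_iff open_segment_commute)
  then show ?R using x y xy by blast
qed (unfold crosses_in_order_def, blast)

lemma colour_pair:
  assumes alt: "alternating_colouring n white" and "u < 2 * n + 2" "v < 2 * n + 2" "even u" "odd v"
  shows "white_end white {u, v} = (if white 0 then u else v)"
    "black_end white {u, v} = (if white 0 then v else u)"
  using alternating_parity[OF alt, of u] alternating_parity[OF alt, of v] assms
  by (simp_all add: white_end_pair black_end_pair)

lemma fanE:
  assumes "l \<in> fan n"
  obtains m where "l = {0, m}" "odd m" "m < 2 * n + 2"
  using assms by (auto simp: fan_def)

text \<open>The blue edge \<open>(0, p2 + 1)\<close> crosses the sides \<open>(p5, p0)\<close> and \<open>(p2, p3)\<close>, in this order when seen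
  from 0. In the negative part, the white ends of the two diagonals force the pair of sides to be
  \<open>(p2, p3)\<close> and \<open>(p5, p0)\<close> in the wrong order.\<close>

lemma long_edge_passes_hexagon:
  assumes alt: "alternating_colouring n white" and H: "hexagon n p0 p1 p2 p3 p4 p5"
  shows "long_edge_passes n white {p0, p1, p2, p3, p4, p5} {p0, p3} {p2, p5}"
    and "\<not> long_edge_passes n white {p0, p1, p2, p3, p4, p5} {p2, p5} {p0, p3}"
proof -
  let ?H = "{p0, p1, p2, p3, p4, p5}"
  have less: "p0 < p1" "p1 < p2" "p2 < p3" "p3 < p4" "p4 < p5" "p5 < 2 * n + 2"
    and par: "even p0" "odd p1" "even p2" "odd p3" "even p4" "odd p5"
    using H by (auto simp: hexagon_def)
  note sides = hexagon_sides[OF less(1-5)]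
  have ends: "white_end white {p0, p3} = (if white 0 then p0 else p3)"
    "white_end white {p2, p5} = (if white 0 then p2 else p5)"
    using colour_pair[OF alt, of p0 p3] colour_pair[OF alt, of p2 p5] less par by auto
  note order = nested_chords_crossing_order[of "2 * p0 + 1" "2 * p2 + 1" "2 * p3 + 1" "2 * p5 + 1" n]
  show "long_edge_passes n white ?H {p0, p3} {p2, p5}"
  proof -
    \<comment> \<open>The red vertex \<open>p2\<close> precedes the blue vertex \<open>p2 + 1\<close>, which precedes the red \<open>p3\<close>.\<close>
    define m where "m = Suc p2"
    have m: "m < 2 * n + 2" "odd m" using less par by (auto simp: m_def)
    have "{0, m} \<in> fan n"
      using less par unfolding fan_def m_def by (auto intro!: exI[of _ "p2 div 2"])
    have l: "white_end white {0, m} = (if white 0 then 0 else m)"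
      "black_end white {0, m} = (if white 0 then m else 0)"
      using colour_pair[OF alt, of 0 m] m by auto
    have "chord n 0 (2 * m) \<inter> chord n (2 * p0 + 1) (2 * p5 + 1) \<noteq> {}"
      by (subst chords_cross_iff) (use less m in \<open>auto simp: m_def\<close>)
    then obtain X where X: "X \<in> chord n 0 (2 * m)" "X \<in> chord n (2 * p0 + 1) (2 * p5 + 1)" by blast
    have "chord n 0 (2 * m) \<inter> chord n (2 * p2 + 1) (2 * p3 + 1) \<noteq> {}"
      by (subst chords_cross_iff) (use less m in \<open>auto simp: m_def\<close>)
    then obtain Y where Y: "Y \<in> chord n 0 (2 * m)" "Y \<in> chord n (2 * p2 + 1) (2 * p3 + 1)" by blast
    note XY = order[OF _ _ _ _ _ X Y]
    show ?thesis
    proof (cases "white 0")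
      case True
      have "crosses_in_order n white {0, m} {p5, p0} {p2, p3}"
        unfolding crosses_in_order_pair l blue_circle_point red_circle_point using True X Y XY less
        by (intro exI[of _ X] exI[of _ Y]) (auto simp: open_segment_commute)
      then show ?thesis unfolding long_edge_passes_def
        using \<open>{0, m} \<in> fan n\<close> True
        by (intro bexI[of _ "{0, m}"] exI[of _ 5]) (auto simp: sides ends)
    next
      case False
      have "crosses_in_order n white {0, m} {p2, p3} {p5, p0}"
        unfolding crosses_in_order_pair l blue_circle_point red_circle_point using False X Y XY less
        by (intro exI[of _ Y] exI[of _ X]) (auto simp: open_segment_commute)
      then show ?thesis unfolding long_edge_passes_def
        using \<open>{0, m} \<in> fan n\<close> False
        by (intro bexI[of _ "{0, m}"] exI[of _ 2]) (auto simp: sides ends)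
    qed
  qed
  show "\<not> long_edge_passes n white ?H {p2, p5} {p0, p3}"
  proof
    assume "long_edge_passes n white ?H {p2, p5} {p0, p3}"
    then obtain l k where l: "l \<in> fan n" and k: "k < 6"
      and cr: "crosses_in_order n white l (side ?H k) (side ?H ((k + 3) mod 6))"
      and we: "white_end white {p2, p5} \<in> side ?H k" "white_end white {p0, p3} \<in> side ?H ((k + 3) mod 6)"
      unfolding long_edge_passes_def by blast
    obtain m where m: "l = {0, m}" "odd m" "m < 2 * n + 2" using fanE[OF l] .
    have lends: "white_end white l = (if white 0 then 0 else m)"
      "black_end white l = (if white 0 then m else 0)"
      unfolding m(1) using colour_pair[OF alt, of 0 m] m by auto
    have "k \<in> {0, 1, 2, 3, 4, 5}" using k by auto
    \<comment> \<open>The corner \<open>p2\<close> also lies on the side \<open>(p1, p2)\<close> and \<open>p5\<close> on \<open>(p4, p5)\<close>, but the sides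
      opposite to these do not contain the white end of the other diagonal.\<close>
    then have sd: "if white 0 then side ?H k = {p2, p3} \<and> side ?H ((k + 3) mod 6) = {p5, p0}
        else side ?H k = {p5, p0} \<and> side ?H ((k + 3) mod 6) = {p2, p3}"
      using we less by (auto simp: sides sides(2)[unfolded One_nat_def] ends split: if_splits)
    show False
    proof (cases "white 0")
      case True
      then have "crosses_in_order n white l {p2, p3} {p5, p0}" using sd cr by simp
      then obtain Y X where Y: "Y \<in> chord n 0 (2 * m)" "Y \<in> chord n (2 * p2 + 1) (2 * p3 + 1)"
        and X: "X \<in> chord n 0 (2 * m)" "X \<in> chord n (2 * p0 + 1) (2 * p5 + 1)"
        and "Y \<in> open_segment (circle_point n 0) X"
        unfolding crosses_in_order_pair lends blue_circle_point red_circle_point using True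
        by (auto simp: open_segment_commute)
      then show False using order(4)[OF _ _ _ _ _ X Y] less by auto
    next
      case False
      then have "crosses_in_order n white l {p5, p0} {p2, p3}" using sd cr by simp
      then obtain Y X where Y: "Y \<in> chord n 0 (2 * m)" "Y \<in> chord n (2 * p2 + 1) (2 * p3 + 1)"
        and X: "X \<in> chord n 0 (2 * m)" "X \<in> chord n (2 * p0 + 1) (2 * p5 + 1)"
        and "X \<in> open_segment (circle_point n (2 * m)) Y"
        unfolding crosses_in_order_pair lends blue_circle_point red_circle_point using False
        by (auto simp: open_segment_commute)
      then show False using order(3)[OF _ _ _ _ _ X Y] less by auto
    qed
  qed
qed

section \<open>Binary trees as systems of arcs\<close>

text \<open>A tree with \<open>s\<close> nodes placed at the vertex \<open>a\<close> occupies the vertices from \<open>a\<close> to \<open>a + 2 s + 1\<close>, the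
  corners of a polygon that \<open>s\<close> squares can fill.\<close>

definition reach :: "nat \<Rightarrow> 'a tree \<Rightarrow> nat" where
  "reach a t = a + 2 * size t + 1"

lemma reach_simps [simp]:
  "reach a Leaf = Suc a"
  "reach a (Node l x r) = reach (Suc (reach a l)) r"
  by (simp_all add: reach_def)

lemma reach_greater: "a < reach a t"
  by (simp add: reach_def)

lemma reach_odd: "even a \<Longrightarrow> odd (reach a t)"
  by (simp add: reach_def)

lemma reach_size: "reach a t = reach a t' \<longleftrightarrow> size t = size t'"
  by (simp add: reach_def)

text \<open>The sides and diagonals of the quadrangulation with dual tree \<open>t\<close> of the polygon with corners
  \<open>a, \<dots>, reach a t\<close>. The middle side of each square has length one.\<close>

fun tree_arcs :: "nat \<Rightarrow> 'a tree \<Rightarrow> (nat \<times> nat) set" where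
  "tree_arcs a Leaf = {(a, Suc a)}"
| "tree_arcs a (Node l x r) =
    {(a, reach a (Node l x r)), (reach a l, Suc (reach a l))} \<union> tree_arcs a l \<union>
      tree_arcs (Suc (reach a l)) r"

fun tree_quads :: "nat \<Rightarrow> 'a tree \<Rightarrow> (nat \<times> nat \<times> nat \<times> nat) set" where
  "tree_quads a Leaf = {}"
| "tree_quads a (Node l x r) =
    insert (a, reach a l, Suc (reach a l), reach a (Node l x r))
      (tree_quads a l \<union> tree_quads (Suc (reach a l)) r)"

lemma tree_arcs_bounds:
  assumes "(u, v) \<in> tree_arcs a t"
  shows "a \<le> u" "u < v" "v \<le> reach a t"
proof -
  have "a \<le> u \<and> u < v \<and> v \<le> reach a t" using assms
  proof (induction t arbitrary: a)
    case (Node l x r)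
    show ?case
      using Node.prems Node.IH(1)[of a] Node.IH(2)[of "Suc (reach a l)"]
        reach_greater[of a l] reach_greater[of "Suc (reach a l)" r]
      by auto
  qed auto
  then show "a \<le> u" "u < v" "v \<le> reach a t" by auto
qed

text \<open>Left subtrees are placed at \<open>a\<close> and right subtrees at the vertex after an odd one, so all subtrees
  start at even vertices.\<close>

lemma tree_arcs_parity:
  assumes "(u, v) \<in> tree_arcs a t" "even a"
  shows "v = Suc u \<or> even u \<and> odd v"
  using assms
proof (induction t arbitrary: a)
  case (Node l x r)
  let ?c = "Suc (reach a l)"
  have odd: "odd (reach a l)" "even ?c" using reach_odd[OF Node.prems(2)] by auto
  have "odd (reach ?c r)" by (rule reach_odd[OF odd(2)])
  then show ?case
    using Node.prems Node.IH(1)[OF _ Node.prems(2)] Node.IH(2)[OF _ odd(2)] odd by auto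
qed auto

lemma tree_arcs_root: "(a, reach a t) \<in> tree_arcs a t"
  by (cases t) auto

lemma tree_arcs_unit: "a \<le> u \<Longrightarrow> u < reach a t \<Longrightarrow> (u, Suc u) \<in> tree_arcs a t"
proof (induction t arbitrary: a)
  case (Node l x r)
  consider "u < reach a l" | "u = reach a l" | "Suc (reach a l) \<le> u" by linarith
  then show ?case using Node by cases auto
qed auto

lemma noncrossing_tree_arcs: "noncrossing (tree_arcs a t)"
proof (induction t arbitrary: a)
  case (Node l x r)
  let ?b = "reach a l" and ?c = "Suc (reach a l)"
  show ?case unfolding noncrossing_def
  proof (intro allI impI notI)
    fix u v y z
    assume uv: "(u, v) \<in> tree_arcs a (Node l x r)" and yz: "(y, z) \<in> tree_arcs a (Node l x r)"
      and less: "u < y \<and> y < v \<and> v < z"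
    have z: "z \<le> reach a (Node l x r)" and u: "a \<le> u"
      using tree_arcs_bounds[OF yz] tree_arcs_bounds[OF uv] by auto
    have "(u, v) \<in> tree_arcs a l \<or> (u, v) \<in> tree_arcs ?c r" using uv less z by auto
    moreover have "(y, z) \<in> tree_arcs a l \<or> (y, z) \<in> tree_arcs ?c r" using yz less u by auto
    ultimately consider "(u, v) \<in> tree_arcs a l" "(y, z) \<in> tree_arcs a l"
      | "(u, v) \<in> tree_arcs ?c r" "(y, z) \<in> tree_arcs ?c r"
      | "(u, v) \<in> tree_arcs a l" "(y, z) \<in> tree_arcs ?c r"
      | "(u, v) \<in> tree_arcs ?c r" "(y, z) \<in> tree_arcs a l" by blast
    then show False
    proof cases
      case 1 then show ?thesis using less noncrossingD[OF Node.IH(1)] by blast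
    next
      case 2 then show ?thesis using less noncrossingD[OF Node.IH(2)] by blast
    next
      case 3 then show ?thesis using less tree_arcs_bounds(3)[OF 3(1)] tree_arcs_bounds(1)[OF 3(2)] by simp
    next
      case 4 then show ?thesis using less tree_arcs_bounds(1)[OF 4(1)] tree_arcs_bounds(3)[OF 4(2)] by simp
    qed
  qed
qed (auto simp: noncrossing_def)

lemma tree_quads_quad:
  assumes "(u, b, c, v) \<in> tree_quads a t" "even a"
  shows "u < b" "c = Suc b" "c < v" "even u" "odd b" "odd v"
    "(u, b) \<in> tree_arcs a t" "(b, c) \<in> tree_arcs a t" "(c, v) \<in> tree_arcs a t" "(u, v) \<in> tree_arcs a t"
proof -
  have "u < b \<and> c = Suc b \<and> c < v \<and> even u \<and> odd b \<and> odd v \<and> (u, b) \<in> tree_arcs a t \<and>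
      (b, c) \<in> tree_arcs a t \<and> (c, v) \<in> tree_arcs a t \<and> (u, v) \<in> tree_arcs a t"
    using assms
  proof (induction t arbitrary: a)
    case (Node l x r)
    let ?c = "Suc (reach a l)"
    have "even ?c" using reach_odd[OF Node.prems(2)] by simp
    consider "(u, b, c, v) = (a, reach a l, ?c, reach ?c r)" | "(u, b, c, v) \<in> tree_quads a l"
      | "(u, b, c, v) \<in> tree_quads ?c r" using Node.prems by auto
    then show ?case
    proof cases
      case 1
      then show ?thesis
        using Node.prems(2) \<open>even ?c\<close> reach_greater[of a l] reach_greater[of ?c r] reach_odd[of a l]
          reach_odd[of ?c r] tree_arcs_root[of a l] tree_arcs_root[of ?c r] by auto
    next
      case 2 then show ?thesis using Node.IH(1)[OF _ Node.prems(2)] by auto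
    next
      case 3 then show ?thesis using Node.IH(2)[OF _ \<open>even ?c\<close>] by auto
    qed
  qed auto
  then show "u < b" "c = Suc b" "c < v" "even u" "odd b" "odd v"
    "(u, b) \<in> tree_arcs a t" "(b, c) \<in> tree_arcs a t" "(c, v) \<in> tree_arcs a t" "(u, v) \<in> tree_arcs a t"
    by auto
qed

lemma tree_quads_imp_quad:
  assumes "(u, b, c, v) \<in> tree_quads a t" "even a"
  shows "quad (tree_arcs a t) u b c v"
  using tree_quads_quad[OF assms] tree_arcs_parity[OF _ assms(2), of u c t]
    tree_arcs_parity[OF _ assms(2), of b v t]
  by (auto simp: quad_def)

lemma tree_arcs_quad:
  assumes "(u, v) \<in> tree_arcs a t" "v \<noteq> Suc u"
  shows "\<exists>b c. (u, b, c, v) \<in> tree_quads a t"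
  using assms
proof (induction t arbitrary: a)
  case (Node l x r)
  consider "u = a" "v = reach a (Node l x r)" | "(u, v) \<in> tree_arcs a l"
    | "(u, v) \<in> tree_arcs (Suc (reach a l)) r"
    using Node.prems by auto
  then show ?case
  proof cases
    case 2 then show ?thesis using Node.IH(1)[OF _ Node.prems(2)] by fastforce
  next
    case 3 then show ?thesis using Node.IH(2)[OF _ Node.prems(2)] by fastforce
  qed auto
qed auto

text \<open>The dual tree, labelled by squares, that \<^term>\<open>tree_arcs a t\<close> ought to have; its ternary version
  follows.\<close>

fun square_tree :: "nat \<Rightarrow> 'a tree \<Rightarrow> nat set tree" where
  "square_tree a Leaf = Leaf"
| "square_tree a (Node l x r) = Node (square_tree a l)
     {a, reach a l, Suc (reach a l), reach a (Node l x r)} (square_tree (Suc (reach a l)) r)"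

fun square_ttree :: "nat \<Rightarrow> 'a tree \<Rightarrow> nat set ttree" where
  "square_ttree a Leaf = TLeaf"
| "square_ttree a (Node l x r) = TNode
     {a, reach a l, Suc (reach a l), reach a (Node l x r)} (square_ttree a l) TLeaf
     (square_ttree (Suc (reach a l)) r)"

primrec to_ternary :: "'a tree \<Rightarrow> 'a ttree" where
  "to_ternary Leaf = TLeaf"
| "to_ternary (Node l x r) = TNode x (to_ternary l) TLeaf (to_ternary r)"

lemma to_binary_square_ttree: "to_binary (square_ttree a t) = square_tree a t"
  by (induction t arbitrary: a) auto

lemma binary_shape_Node: "binary_shape (Node l x r) = Node (binary_shape l) () (binary_shape r)"
  by (simp add: binary_shape_def)

lemma binary_shape_square_tree: "binary_shape (square_tree a t) = (t :: unit tree)"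
  by (induction t arbitrary: a) (auto simp: binary_shape_def)

lemma ternary_shape_square_ttree: "ternary_shape (square_ttree a t) = to_ternary (t :: unit tree)"
  by (induction t arbitrary: a) (auto simp: ternary_shape_def)

lemma to_ternary_bij:
  "bij_betw to_ternary {t :: 'a tree. size t = n} {t. nodes t = n \<and> no_middle t}"
proof -
  have "to_binary (to_ternary t) = t" "nodes (to_ternary t) = size t" "no_middle (to_ternary t)"
    for t :: "'a tree"
    by (induction t) auto
  moreover have "no_middle t \<Longrightarrow> to_ternary (to_binary t) = t \<and> size (to_binary t) = nodes t"
    for t :: "'a ttree"
    by (induction t) auto
  ultimately show ?thesis by (intro bij_betwI[where g = to_binary]) auto
qed

section \<open>Compatible quadrangulations and binary trees\<close>

definition tree_diagonals :: "unit tree \<Rightarrow> nat set set" where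
  "tree_diagonals t = {{u, v} |u v. (u, v) \<in> tree_arcs 0 t \<and> v \<noteq> Suc u \<and> (u, v) \<noteq> (0, reach 0 t)}"

lemma tree_diagonals_iff:
  assumes "u < v"
  shows "{u, v} \<in> tree_diagonals t \<longleftrightarrow>
    (u, v) \<in> tree_arcs 0 t \<and> v \<noteq> Suc u \<and> (u, v) \<noteq> (0, reach 0 t)"
proof
  assume "{u, v} \<in> tree_diagonals t"
  then obtain x y where "{u, v} = {x, y}" "(x, y) \<in> tree_arcs 0 t" "y \<noteq> Suc x" "(x, y) \<noteq> (0, reach 0 t)"
    by (auto simp: tree_diagonals_def)
  moreover from this have "x < y" using tree_arcs_bounds(2) by blast
  ultimately show "(u, v) \<in> tree_arcs 0 t \<and> v \<noteq> Suc u \<and> (u, v) \<noteq> (0, reach 0 t)"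
    using assms by (auto simp: doubleton_eq_iff)
qed (auto simp: tree_diagonals_def)

lemma arcs_tree_diagonals:
  assumes "n \<ge> 1" "size t = n"
  shows "arcs n (tree_diagonals t) = tree_arcs 0 t"
proof -
  have reach: "reach 0 t = 2 * n + 1" using assms(2) by (simp add: reach_def)
  have "(u, v) \<in> arcs n (tree_diagonals t) \<longleftrightarrow> (u, v) \<in> tree_arcs 0 t" for u v
  proof (cases "u < v")
    case True
    have "(u, v) \<in> tree_arcs 0 t" if "v < 2 * n + 2" "v = Suc u \<or> u = 0 \<and> v = 2 * n + 1"
      using that tree_arcs_unit[of 0 u t] tree_arcs_root[of 0 t] reach by auto
    then show ?thesis
      using True tree_arcs_bounds(3)[of u v 0 t] reach
      unfolding arcs_iff[OF assms(1)] tree_diagonals_iff[OF True] by auto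
  qed (use tree_arcs_bounds(2) in \<open>auto simp: arcs_def\<close>)
  then show ?thesis by auto
qed

lemma tree_diagonals_diagonals:
  assumes "n \<ge> 1" "size t = n"
  shows "tree_diagonals t \<subseteq> diagonals n"
proof
  fix e assume "e \<in> tree_diagonals t"
  then obtain u v where uv: "e = {u, v}" "(u, v) \<in> tree_arcs 0 t" "v \<noteq> Suc u" "(u, v) \<noteq> (0, reach 0 t)"
    by (auto simp: tree_diagonals_def)
  then show "e \<in> diagonals n"
    using tree_arcs_bounds[OF uv(2)] assms by (auto simp: diagonal_iff reach_def)
qed

lemma tree_diagonals_compatible:
  assumes n: "n \<ge> 1" and alt: "alternating_colouring n white" and t: "size t = n"
  shows "tree_diagonals t \<in> compatible_quadrangulations n white (fan n)"
proof -
  have "\<exists>b c. quad (tree_arcs 0 t) a b c d" if "(a, d) \<in> tree_arcs 0 t" "d \<noteq> Suc a" for a d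
    using tree_arcs_quad[OF that] tree_quads_imp_quad by blast
  then show ?thesis
    unfolding compatible_quadrangulations_iff[OF n alt] quadrangulation_iff[OF n] arcs_tree_diagonals[OF n t]
    using tree_diagonals_diagonals[OF n t] noncrossing_tree_arcs tree_arcs_parity by blast
qed

lemma diagonals_eqI:
  assumes n: "n \<ge> 1" and D: "D \<subseteq> diagonals n" "D' \<subseteq> diagonals n" and arcs: "arcs n D = arcs n D'"
  shows "D = D'"
proof -
  have "D1 \<subseteq> D2" if D: "D1 \<subseteq> diagonals n" "arcs n D1 = arcs n D2" for D1 D2
  proof
    fix e assume e: "e \<in> D1"
    then have diag: "e \<in> diagonals n" using D by blast
    then obtain u v where uv: "u < v" "e = {u, v}" by (rule diagonalE)
    then have "(u, v) \<in> arcs n D2" using e D(2) arcs_iff[OF n] by blast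
    then show "e \<in> D2" using diag uv by (auto simp: arcs_iff[OF n] diagonal_iff[OF n])
  qed
  from this[of D D'] this[of D' D] show ?thesis using assms by blast
qed

text \<open>The square below the arc \<open>(a, d)\<close> has its corner \<open>b\<close> at an odd vertex, so its middle side, starting
  there, is a boundary edge. The arcs below \<open>(a, d)\<close> are then those below the left side and those below
  the right side, to which the induction hypothesis applies, and the two arcs \<open>(a, d)\<close> and \<open>(b, c)\<close>:
  any other arc would cross a side of the square or be one of its diagonals.\<close>

lemma arcs_below_tree:
  assumes n: "n \<ge> 1" and alt: "alternating_colouring n white"
    and D: "D \<in> compatible_quadrangulations n white (fan n)"
    and ad: "(a, d) \<in> arcs n D" "even a"
  shows "\<exists>t :: unit tree. reach a t = d \<and> tree_arcs a t = {(u, v) \<in> arcs n D. a \<le> u \<and> v \<le> d}"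
  using ad
proof (induction "d - a" arbitrary: a d rule: less_induct)
  case less
  let ?A = "arcs n D"
  have Q: "quadrangulation n D" and even: "\<And>u v. (u, v) \<in> ?A \<Longrightarrow> v = Suc u \<or> even u"
    using D by (auto simp: compatible_quadrangulations_iff[OF n alt])
  then have diag: "D \<subseteq> diagonals n" and nc: "noncrossing ?A" by (auto simp: quadrangulation_iff[OF n])
  note bounded = arcs_bounded[OF n diag]
  show ?case
  proof (cases "d = Suc a")
    case True
    have "u = a \<and> v = Suc a" if "(u, v) \<in> ?A" "a \<le> u" "v \<le> Suc a" for u v
      using bounded[OF that(1)] that by auto
    then have "{(u, v) \<in> ?A. a \<le> u \<and> v \<le> d} = {(a, Suc a)}" using less.prems True by auto
    then show ?thesis using True by (intro exI[of _ Leaf]) simp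
  next
    case False
    then obtain b c where "quad ?A a b c d"
      using Q less.prems unfolding quadrangulation_iff[OF n] by blast
    then have lt: "a < b" "b < c" "c < d" and A: "(a, b) \<in> ?A" "(b, c) \<in> ?A" "(c, d) \<in> ?A"
      and notA: "(a, c) \<notin> ?A" "(b, d) \<notin> ?A" by (auto simp: quad_def)
    have "odd b" using quadrangulation_arc_parity[OF n Q A(1)] less.prems(2) by simp
    then have c: "c = Suc b" using even[OF A(2)] by simp
    have "\<exists>l :: unit tree. reach a l = b \<and> tree_arcs a l = {(u, v) \<in> ?A. a \<le> u \<and> v \<le> b}"
      by (rule less.hyps[OF _ A(1) less.prems(2)]) (use lt in simp)
    then obtain l :: "unit tree" where l: "reach a l = b" "tree_arcs a l = {(u, v) \<in> ?A. a \<le> u \<and> v \<le> b}"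
      by blast
    have "\<exists>r :: unit tree. reach c r = d \<and> tree_arcs c r = {(u, v) \<in> ?A. c \<le> u \<and> v \<le> d}"
      by (rule less.hyps[OF _ A(3)]) (use lt c \<open>odd b\<close> in simp_all)
    then obtain r :: "unit tree" where r: "reach c r = d" "tree_arcs c r = {(u, v) \<in> ?A. c \<le> u \<and> v \<le> d}"
      by blast
    have split: "(u, v) = (a, d) \<or> (u, v) = (b, c) \<or> a \<le> u \<and> v \<le> b \<or> c \<le> u \<and> v \<le> d"
      if uv: "(u, v) \<in> ?A" "a \<le> u" "v \<le> d" for u v
    proof (rule ccontr)
      assume neg: "\<not> ?thesis"
      then have "b < v" "u < c" using uv by auto
      consider "u = a" | "a < u" "u < b" | "u = b" using uv \<open>u < c\<close> c by linarith
      then show False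
      proof cases
        case 1
        then have "v \<noteq> d" "v \<noteq> c" using neg notA uv by auto
        then show False using noncrossingD[OF nc uv(1) A(3)] 1 \<open>b < v\<close> uv c lt by auto
      next
        case 2
        then show False using noncrossingD[OF nc A(1) uv(1)] \<open>b < v\<close> by blast
      next
        case 3
        then have "v \<noteq> d" "v \<noteq> c" using neg notA uv by auto
        then show False using noncrossingD[OF nc uv(1) A(3)] 3 \<open>b < v\<close> uv c lt by auto
      qed
    qed
    have "{(u, v) \<in> ?A. a \<le> u \<and> v \<le> d} = {(a, d), (b, c)} \<union> {(u, v) \<in> ?A. a \<le> u \<and> v \<le> b} \<union>
        {(u, v) \<in> ?A. c \<le> u \<and> v \<le> d}"
      using split less.prems(1) A(2) lt by auto
    then have "tree_arcs a (Node l () r) = {(u, v) \<in> ?A. a \<le> u \<and> v \<le> d}"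
      using l r c by simp
    moreover have "reach a (Node l () r) = d" using l r c by simp
    ultimately show ?thesis by blast
  qed
qed

lemma compatible_is_tree:
  assumes n: "n \<ge> 1" and alt: "alternating_colouring n white"
    and D: "D \<in> compatible_quadrangulations n white (fan n)"
  obtains t where "size t = n" "D = tree_diagonals t"
proof -
  have diag: "D \<subseteq> diagonals n"
    using D by (auto simp: compatible_quadrangulations_iff[OF n alt] quadrangulation_def)
  have "(0, 2 * n + 1) \<in> arcs n D" by (simp add: arcs_iff[OF n])
  then obtain t :: "unit tree" where t: "reach 0 t = 2 * n + 1"
    "tree_arcs 0 t = {(u, v) \<in> arcs n D. 0 \<le> u \<and> v \<le> 2 * n + 1}"
    using arcs_below_tree[OF n alt D] by blast
  have "size t = n" using t(1) by (simp add: reach_def)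
  moreover have "tree_arcs 0 t = arcs n D"
    unfolding t(2) using arcs_bounded(2)[OF n diag] by fastforce
  then have "D = tree_diagonals t"
    by (intro diagonals_eqI[OF n diag tree_diagonals_diagonals[OF n \<open>size t = n\<close>]])
      (simp add: arcs_tree_diagonals[OF n \<open>size t = n\<close>])
  ultimately show thesis using that by blast
qed

lemma square_side_simps:
  assumes "a < b" "b < c" "c < (d :: nat)"
  shows "left_side {a, b, c, d} = {a, b}" "middle_side {a, b, c, d} = {b, c}"
    "right_side {a, b, c, d} = {c, d}" "entrance {a, b, c, d} = {d, a}"
proof -
  have "sorted_list_of_set {a, b, c, d} = [a, b, c, d]"
    using assms by (intro sorted_list_of_set.sorted_key_list_of_set_unique[THEN iffD1, simplified]) auto
  then show "left_side {a, b, c, d} = {a, b}" "middle_side {a, b, c, d} = {b, c}"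
    "right_side {a, b, c, d} = {c, d}" "entrance {a, b, c, d} = {d, a}"
    using assms by (simp_all add: left_side_def middle_side_def right_side_def entrance_def side_def)
qed

lemma squares_tree_diagonals:
  assumes n: "n \<ge> 1" and t: "size t = n"
  shows "F \<in> squares n (tree_diagonals t) \<longleftrightarrow> (\<exists>a b c d. (a, b, c, d) \<in> tree_quads 0 t \<and> F = {a, b, c, d})"
proof -
  note diag = tree_diagonals_diagonals[OF n t] and arcs = arcs_tree_diagonals[OF n t]
  have "quad (tree_arcs 0 t) a b c d \<longleftrightarrow> (a, b, c, d) \<in> tree_quads 0 t" for a b c d
  proof
    assume q: "quad (tree_arcs 0 t) a b c d"
    then have "(a, d) \<in> tree_arcs 0 t" "d \<noteq> Suc a" by (auto simp: quad_def)
    then obtain b' c' where q': "(a, b', c', d) \<in> tree_quads 0 t" using tree_arcs_quad by blast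
    then have "quad (tree_arcs 0 t) a b' c' d" by (simp add: tree_quads_imp_quad)
    then have "b' = b \<and> c' = c"
      using quad_unique[OF n diag, unfolded arcs, OF noncrossing_tree_arcs q] by blast
    then show "(a, b, c, d) \<in> tree_quads 0 t" using q' by simp
  qed (simp add: tree_quads_imp_quad)
  then show ?thesis unfolding squares_iff[OF n diag] arcs by simp
qed

lemma tree_quads_unique:
  fixes t :: "unit tree"
  assumes n: "n \<ge> 1" and t: "size t = n"
    and "(a, b, c, d) \<in> tree_quads 0 t" "(a, b', c', d) \<in> tree_quads 0 t"
  shows "b' = b \<and> c' = c"
  using quad_unique[OF n tree_diagonals_diagonals[OF n t], unfolded arcs_tree_diagonals[OF n t],
      OF noncrossing_tree_arcs] assms(3,4)[THEN tree_quads_imp_quad, simplified] by blast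

text \<open>Stated for all subtrees \<open>t\<close> of a fixed tree \<open>s\<close>, since \<^const>\<open>dual_subtree\<close> always refers to the
  whole quadrangulation. Uniqueness of the square with a given entrance makes the choice in its
  definition harmless.\<close>

lemma dual_subtree_tree_diagonals:
  fixes s t :: "unit tree"
  assumes n: "n \<ge> 1" and s: "size s = n" and sub: "tree_quads a t \<subseteq> tree_quads 0 s"
  shows "dual_subtree n (tree_diagonals s) {a, reach a t} = square_ttree a t"
  using sub
proof (induction t arbitrary: a)
  case Leaf
  have "entrance F \<noteq> {a, Suc a}" if "F \<in> squares n (tree_diagonals s)" for F
    using that by (elim square_sides) (auto simp: doubleton_eq_iff)
  then show ?case by (subst dual_subtree.simps) auto
next
  case (Node l x r)
  let ?D = "tree_diagonals s"
  define b where "b = reach a l"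
  define c where "c = Suc b"
  define d where "d = reach c r"
  let ?F = "{a, b, c, d}"
  have "(a, b, c, d) \<in> tree_quads 0 s" using Node.prems by (simp add: b_def c_def d_def)
  then have F: "?F \<in> squares n ?D" using squares_tree_diagonals[OF n s] by blast
  have less: "a < b" "b < c" "c < d" by (simp_all add: b_def c_def d_def reach_greater)
  note sides = square_side_simps[OF less]
  have unique: "G = ?F" if G: "G \<in> squares n ?D" "entrance G = {a, d}" for G
  proof -
    obtain a' b' c' d' where q: "(a', b', c', d') \<in> tree_quads 0 s" "G = {a', b', c', d'}"
      using G(1) unfolding squares_tree_diagonals[OF n s] by blast
    have less': "a' < b'" "b' < c'" "c' < d'" using tree_quads_quad(1-3)[OF q(1) even_zero] by simp_all
    have "{d', a'} = {a, d}" using G(2) unfolding q(2) square_side_simps(4)[OF less'] .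
    then have "a' = a \<and> d' = d" using less less' by (auto simp: doubleton_eq_iff)
    then show ?thesis using q \<open>(a, b, c, d) \<in> tree_quads 0 s\<close> tree_quads_unique[OF n s] by blast
  qed
  have ex: "\<exists>F\<in>squares n ?D. entrance F = {a, d}" 
    by (rule bexI[OF _ F]) (simp add: sides insert_commute)
  have some: "(SOME F. F \<in> squares n ?D \<and> entrance F = {a, d}) = ?F"
  proof (rule some_equality)
    show "?F \<in> squares n ?D \<and> entrance ?F = {a, d}"
      by (intro conjI F) (simp add: sides insert_commute)
  qed (use unique in blast)
  have "entrance G \<noteq> {b, c}" if "G \<in> squares n ?D" for G
    using that by (elim square_sides) (auto simp: doubleton_eq_iff c_def)
  then have middle: "dual_subtree n ?D {b, c} = TLeaf" by (subst dual_subtree.simps) auto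
  have left: "dual_subtree n ?D {a, b} = square_ttree a l"
    using Node.IH(1)[of a] Node.prems by (simp add: b_def)
  have right: "dual_subtree n ?D {c, d} = square_ttree c r"
    using Node.IH(2)[of c] Node.prems by (simp add: b_def c_def d_def)
  have "dual_subtree n ?D {a, d} = TNode ?F (square_ttree a l) TLeaf (square_ttree c r)"
    by (subst dual_subtree.simps) (simp add: ex some sides left middle right Let_def del: insert_iff)
  then show ?case by (simp add: b_def c_def d_def)
qed

lemma dual_tree_tree_diagonals:
  assumes "n \<ge> 1" "size t = n"
  shows "dual_tree n (tree_diagonals t) = square_ttree 0 t"
    and "binary_dual_tree n (tree_diagonals t) = square_tree 0 t"
proof -
  have "reach 0 t = 2 * n + 1" using assms(2) by (simp add: reach_def)
  then show *: "dual_tree n (tree_diagonals t) = square_ttree 0 t"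
    using dual_subtree_tree_diagonals[OF assms, of 0 t]
    by (simp add: dual_tree_def root_edge_def insert_commute)
  then show "binary_dual_tree n (tree_diagonals t) = square_tree 0 t"
    by (simp add: binary_dual_tree_def to_binary_square_ttree)
qed

lemma compatible_eq_image:
  assumes "n \<ge> 1" "alternating_colouring n white"
  shows "compatible_quadrangulations n white (fan n) = tree_diagonals ` {t. size t = n}"
  using tree_diagonals_compatible[OF assms] compatible_is_tree[OF assms] by blast

lemma tree_diagonals_inj:
  assumes "n \<ge> 1" "size t = n" "size t' = n" "tree_diagonals t = tree_diagonals t'"
  shows "t = t'"
  using dual_tree_tree_diagonals(2)[OF assms(1,2)] dual_tree_tree_diagonals(2)[OF assms(1,3)] assms(4)
    binary_shape_square_tree by metis

section \<open>Rotations as changes inside a hexagon\<close>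

text \<open>The rotation of a tree placed at the vertex \<open>a\<close>, together with the hexagon in which the corresponding
  flip takes place. The corners are found from the sizes of the three subtrees that are moved.\<close>

inductive hexagon_rotation ::
    "nat \<Rightarrow> nat \<Rightarrow> nat \<Rightarrow> nat \<Rightarrow> nat \<Rightarrow> nat \<Rightarrow> nat \<Rightarrow> unit tree \<Rightarrow> unit tree \<Rightarrow> bool"
  for p0 p1 p2 p3 p4 p5 :: nat where
  here: "p1 = reach p0 A \<Longrightarrow> p2 = Suc p1 \<Longrightarrow> p3 = reach p2 B \<Longrightarrow> p4 = Suc p3 \<Longrightarrow> p5 = reach p4 C \<Longrightarrow>
    hexagon_rotation p0 p1 p2 p3 p4 p5 p0 (Node (Node A () B) () C) (Node A () (Node B () C))"
| left: "hexagon_rotation p0 p1 p2 p3 p4 p5 a l l' \<Longrightarrow>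
    hexagon_rotation p0 p1 p2 p3 p4 p5 a (Node l () r) (Node l' () r)"
| right: "hexagon_rotation p0 p1 p2 p3 p4 p5 (Suc (reach a l)) r r' \<Longrightarrow>
    hexagon_rotation p0 p1 p2 p3 p4 p5 a (Node l () r) (Node l () r')"

lemma hexagon_rotation_size:
  assumes "hexagon_rotation p0 p1 p2 p3 p4 p5 a t t'"
  shows "size t' = size t"
  using assms by induction auto

lemma hexagon_rotation_quads:
  assumes "hexagon_rotation p0 p1 p2 p3 p4 p5 a t t'"
  shows "(p0, p1, p2, p3) \<in> tree_quads a t" "(p0, p3, p4, p5) \<in> tree_quads a t"
    "(p0, p1, p2, p5) \<in> tree_quads a t'" "(p2, p3, p4, p5) \<in> tree_quads a t'"
  using assms by (induction) (auto simp: reach_size dest: hexagon_rotation_size)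

lemma hexagon_rotation_bounds:
  assumes "hexagon_rotation p0 p1 p2 p3 p4 p5 a t t'"
  shows "a \<le> p0" "p0 < p1" "p1 < p2" "p2 < p3" "p3 < p4" "p4 < p5" "p5 \<le> reach a t"
proof -
  have "a \<le> p0 \<and> p0 < p1 \<and> p1 < p2 \<and> p2 < p3 \<and> p3 < p4 \<and> p4 < p5 \<and> p5 \<le> reach a t"
    using assms
  proof induction
    case (here A B C)
    then show ?case using reach_greater[of p0 A] reach_greater[of p2 B] reach_greater[of p4 C] by simp
  next
    case (left a l l' r)
    then show ?case using reach_greater[of "Suc (reach a l)" r] by simp
  next
    case (right a l r r')
    then show ?case using reach_greater[of a l] by simp
  qed
  then show "a \<le> p0" "p0 < p1" "p1 < p2" "p2 < p3" "p3 < p4" "p4 < p5" "p5 \<le> reach a t" by auto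
qed

lemma hexagon_rotation_hexagon:
  assumes "hexagon_rotation p0 p1 p2 p3 p4 p5 0 t t'" "size t = n"
  shows "hexagon n p0 p1 p2 p3 p4 p5"
  using hexagon_rotation_bounds[OF assms(1)] assms(2)
    tree_quads_quad[OF hexagon_rotation_quads(1)[OF assms(1)]]
    tree_quads_quad[OF hexagon_rotation_quads(2)[OF assms(1)]]
  by (auto simp: hexagon_def reach_def)

lemma hexagon_rotation_arcs:
  assumes "hexagon_rotation p0 p1 p2 p3 p4 p5 a t t'"
  shows "tree_arcs a t' = insert (p2, p5) (tree_arcs a t - {(p0, p3)})"
  using assms
proof induction
  case (here A B C)
  have less: "p0 < p1" "p1 < p2" "p2 < p3" "p3 < p4" "p4 < p5"
    using here reach_greater[of p0 A] reach_greater[of p2 B] reach_greater[of p4 C] by auto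
  have notin: "(p0, p3) \<notin> tree_arcs p0 A" "(p0, p3) \<notin> tree_arcs p2 B" "(p0, p3) \<notin> tree_arcs p4 C"
    using tree_arcs_bounds(3)[of p0 p3 p0 A] tree_arcs_bounds(1)[of p0 p3 p2 B]
      tree_arcs_bounds(1)[of p0 p3 p4 C] less by (auto simp flip: here(1))
  have before: "tree_arcs p0 (Node (Node A () B) () C) =
      {(p0, p5), (p3, p4), (p0, p3), (p1, p2)} \<union> tree_arcs p0 A \<union> tree_arcs p2 B \<union> tree_arcs p4 C"
    by (auto simp: here)
  have after: "tree_arcs p0 (Node A () (Node B () C)) =
      {(p0, p5), (p1, p2), (p2, p5), (p3, p4)} \<union> tree_arcs p0 A \<union> tree_arcs p2 B \<union> tree_arcs p4 C"
    by (auto simp: here)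
  have "(p0, p3) \<noteq> (p0, p5)" "(p0, p3) \<noteq> (p3, p4)" "(p0, p3) \<noteq> (p1, p2)" using less by auto
  then show ?case unfolding before after using notin by blast
next
  case (left a l l' r)
  note b = hexagon_rotation_bounds[OF left.hyps]
  have "(p0, p3) \<notin> tree_arcs (Suc (reach a l)) r"
    using tree_arcs_bounds(1)[of p0 p3 "Suc (reach a l)" r] b by linarith
  moreover have "(p0, p3) \<noteq> (a, reach a (Node l () r))" "(p0, p3) \<noteq> (reach a l, Suc (reach a l))"
    using b reach_greater[of "Suc (reach a l)" r] by auto
  moreover have reach: "reach a l' = reach a l"
    using hexagon_rotation_size[OF left.hyps] by (simp add: reach_def)
  ultimately show ?case unfolding tree_arcs.simps reach_simps left.IH reach by blast
next
  case (right a l r r')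
  note b = hexagon_rotation_bounds[OF right.hyps]
  have "(p0, p3) \<notin> tree_arcs a l"
    using tree_arcs_bounds(3)[of p0 p3 a l] b by linarith
  moreover have "(p0, p3) \<noteq> (a, reach a (Node l () r))" "(p0, p3) \<noteq> (reach a l, Suc (reach a l))"
    using b reach_greater[of a l] by auto
  moreover have reach: "reach (Suc (reach a l)) r' = reach (Suc (reach a l)) r"
    using hexagon_rotation_size[OF right.hyps] by (simp add: reach_def)
  ultimately show ?case unfolding tree_arcs.simps reach_simps right.IH reach by blast
qed

text \<open>The long left side is the entrance of a left child, which supplies the two missing corners of the
  hexagon.\<close>

lemma rotate_left_branch:
  fixes t :: "unit tree"
  assumes "(p0, p3, p4, p5) \<in> tree_quads a t" "p3 \<noteq> Suc p0"
  shows "\<exists>p1 p2 t'. hexagon_rotation p0 p1 p2 p3 p4 p5 a t t'"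
  using assms
proof (induction t arbitrary: a)
  case (Node l x r)
  consider "(p0, p3, p4, p5) = (a, reach a l, Suc (reach a l), reach a (Node l x r))"
    | "(p0, p3, p4, p5) \<in> tree_quads a l" | "(p0, p3, p4, p5) \<in> tree_quads (Suc (reach a l)) r"
    using Node.prems by auto
  then show ?case
  proof cases
    case 1
    then obtain A y B where "l = Node A y B" using Node.prems(2) by (cases l) auto
    then show ?thesis using 1 hexagon_rotation.here[of "reach a A" a A] by fastforce
  next
    case 2
    then obtain p1 p2 t' where *: "hexagon_rotation p0 p1 p2 p3 p4 p5 a l t'"
      using Node.IH(1) Node.prems(2) by blast
    show ?thesis using hexagon_rotation.left[OF *, of r] by auto
  next
    case 3
    then obtain p1 p2 t' where *: "hexagon_rotation p0 p1 p2 p3 p4 p5 (Suc (reach a l)) r t'"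
      using Node.IH(2) Node.prems(2) by blast
    show ?thesis using hexagon_rotation.right[OF *] by auto
  qed
qed auto

lemma rotate_right_branch:
  fixes t' :: "unit tree"
  assumes "(p0, p1, p2, p5) \<in> tree_quads a t'" "p5 \<noteq> Suc p2"
  shows "\<exists>p3 p4 t. hexagon_rotation p0 p1 p2 p3 p4 p5 a t t'"
  using assms
proof (induction t' arbitrary: a)
  case (Node l x r)
  consider "(p0, p1, p2, p5) = (a, reach a l, Suc (reach a l), reach a (Node l x r))"
    | "(p0, p1, p2, p5) \<in> tree_quads a l" | "(p0, p1, p2, p5) \<in> tree_quads (Suc (reach a l)) r"
    using Node.prems by auto
  then show ?case
  proof cases
    case 1
    then obtain A y B where "r = Node A y B" using Node.prems(2) by (cases r) auto
    then show ?thesis using 1 hexagon_rotation.here[of "reach a l" a l] by fastforce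
  next
    case 2
    then obtain p3 p4 t where *: "hexagon_rotation p0 p1 p2 p3 p4 p5 a t l"
      using Node.IH(1) Node.prems(2) by blast
    show ?thesis using hexagon_rotation.left[OF *, of r] by auto
  next
    case 3
    then obtain p3 p4 t where *: "hexagon_rotation p0 p1 p2 p3 p4 p5 (Suc (reach a l)) t r"
      using Node.IH(2) Node.prems(2) by blast
    show ?thesis using hexagon_rotation.right[OF *] by auto
  qed
qed auto

lemma hexagon_rotation_imp_rotation_at:
  assumes "hexagon_rotation p0 p1 p2 p3 p4 p5 a t t'"
  shows "\<exists>T. rotation_at {p0, p3, p4, p5} (square_tree a t) T \<and> binary_shape T = t'"
  using assms
proof induction
  case (here A B C)
  let ?u = "{p0, p1, p2, p3}" and ?v = "{p0, p3, p4, p5}"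
  let ?A = "square_tree p0 A" and ?B = "square_tree p2 B" and ?C = "square_tree p4 C"
  have "square_tree p0 (Node (Node A () B) () C) = Node (Node ?A ?u ?B) ?v ?C"
    by (simp add: here)
  moreover have "binary_shape (Node ?A ?u (Node ?B ?v ?C)) = Node A () (Node B () C)"
    by (simp add: binary_shape_Node binary_shape_square_tree)
  ultimately show ?case using rotation_at.here[of ?v ?A ?u ?B ?C] by metis
next
  case (left a l l' r)
  then obtain T where "rotation_at {p0, p3, p4, p5} (square_tree a l) T" "binary_shape T = l'" by blast
  then show ?case
    by (auto simp: binary_shape_Node binary_shape_square_tree intro!: exI rotation_at.left)
next
  case (right a l r r')
  then obtain T where "rotation_at {p0, p3, p4, p5} (square_tree (Suc (reach a l)) r) T" "binary_shape T = r'"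
    by blast
  then show ?case
    by (auto simp: binary_shape_Node binary_shape_square_tree intro!: exI rotation_at.right)
qed

lemma rotation_at_imp_hexagon_rotation:
  fixes t :: "unit tree"
  assumes "rotation_at v (square_tree a t) T"
  shows "\<exists>p0 p1 p2 p3 p4 p5. hexagon_rotation p0 p1 p2 p3 p4 p5 a t (binary_shape T) \<and>
    v = {p0, p3, p4, p5}"
  using assms
proof (induction "square_tree a t" T arbitrary: a t)
  case (here A u B C)
  then obtain t1 y tr where t: "t = Node t1 y tr" by (cases t) auto
  with here obtain A' x B' where t1: "t1 = Node A' x B'" by (cases t1) auto
  let ?p2 = "Suc (reach a A')"
  let ?p4 = "Suc (reach ?p2 B')"
  have "hexagon_rotation a (reach a A') ?p2 (reach ?p2 B') ?p4 (reach ?p4 tr) a t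
      (Node A' () (Node B' () tr))"
    using hexagon_rotation.here[OF refl refl refl refl refl, of a A' B' tr] by (simp add: t t1)
  moreover have "A = square_tree a A'" "B = square_tree ?p2 B'" "C = square_tree ?p4 tr"
    "v = {a, reach ?p2 B', ?p4, reach ?p4 tr}"
    using here by (simp_all add: t t1)
  ultimately show ?case by (metis binary_shape_Node binary_shape_square_tree)
next
  case (left l l' x r)
  then obtain tl y tr where t: "t = Node tl y tr" by (cases t) auto
  then have "l = square_tree a tl" "r = square_tree (Suc (reach a tl)) tr" using left by simp_all
  then show ?case
    using left(2)[of a tl] hexagon_rotation.left
    by (fastforce simp: t binary_shape_Node binary_shape_square_tree)
next
  case (right r r' l x)
  then obtain tl y tr where t: "t = Node tl y tr" by (cases t) auto
  then have "l = square_tree a tl" "r = square_tree (Suc (reach a tl)) tr" using right by simp_all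
  then show ?case
    using right(2)[of "Suc (reach a tl)" tr] hexagon_rotation.right
    by (fastforce simp: t binary_shape_Node binary_shape_square_tree)
qed

lemma rotation_iff_hexagon_rotation:
  "rotation t t' \<longleftrightarrow> (\<exists>p0 p1 p2 p3 p4 p5. hexagon_rotation p0 p1 p2 p3 p4 p5 a t t')"
proof
  assume "rotation t t'"
  then have "rotation_at () t t'" by (simp add: rotation_def)
  then show "\<exists>p0 p1 p2 p3 p4 p5. hexagon_rotation p0 p1 p2 p3 p4 p5 a t t'"
  proof (induction arbitrary: a)
    case (here A u B C)
    have "u = ()" "v = ()" for v by simp_all
    then show ?case by (metis hexagon_rotation.here)
  next
    case (left l l' x r)
    from left.IH obtain p0 p1 p2 p3 p4 p5 where "hexagon_rotation p0 p1 p2 p3 p4 p5 a l l'" by blast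
    from hexagon_rotation.left[OF this, of r] show ?case by simp blast
  next
    case (right r r' l x)
    from right.IH obtain p0 p1 p2 p3 p4 p5
      where "hexagon_rotation p0 p1 p2 p3 p4 p5 (Suc (reach a l)) r r'" by blast
    from hexagon_rotation.right[OF this] show ?case by simp blast
  qed
next
  assume "\<exists>p0 p1 p2 p3 p4 p5. hexagon_rotation p0 p1 p2 p3 p4 p5 a t t'"
  then obtain p0 p1 p2 p3 p4 p5 where "hexagon_rotation p0 p1 p2 p3 p4 p5 a t t'" by blast
  then have "rotation_at () t t'"
    by induction (auto intro: rotation_at.intros)
  then show "rotation t t'" by (auto simp: rotation_def)
qed

section \<open>Flips\<close>

lemma hexagon_rotation_diagonals:
  assumes n: "n \<ge> 1" and t: "size t = n" and rot: "hexagon_rotation p0 p1 p2 p3 p4 p5 0 t t'"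
  shows "tree_diagonals t' = insert {p2, p5} (tree_diagonals t - {{p0, p3}})"
    and "{p0, p3} \<in> tree_diagonals t" "{p2, p5} \<in> tree_diagonals t'"
proof -
  note b = hexagon_rotation_bounds[OF rot]
  have t': "size t' = n" using hexagon_rotation_size[OF rot] t by simp
  have reach: "reach 0 t' = reach 0 t" using t t' by (simp add: reach_def)
  have q: "(p0, p3) \<in> tree_arcs 0 t" "(p2, p5) \<in> tree_arcs 0 t'"
    using tree_quads_quad(10)[OF hexagon_rotation_quads(1)[OF rot] even_zero]
      tree_quads_quad(10)[OF hexagon_rotation_quads(4)[OF rot] even_zero] by auto
  show in1: "{p0, p3} \<in> tree_diagonals t" using tree_diagonals_iff[of p0 p3 t] q b by auto
  show in2: "{p2, p5} \<in> tree_diagonals t'" using tree_diagonals_iff[of p2 p5 t'] q b by auto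
  show "tree_diagonals t' = insert {p2, p5} (tree_diagonals t - {{p0, p3}})" (is "?L = ?R")
  proof -
    have "e \<in> ?L \<longleftrightarrow> e \<in> ?R" if e: "e \<in> diagonals n" for e
    proof -
      obtain u v where uv: "u < v" "e = {u, v}" using e by (rule diagonalE)
      have eq: "{u, v} = {p2, p5} \<longleftrightarrow> (u, v) = (p2, p5)" "{u, v} = {p0, p3} \<longleftrightarrow> (u, v) = (p0, p3)"
        using uv b by (auto simp: doubleton_eq_iff)
      have long: "p5 \<noteq> Suc p2" "(p2, p5) \<noteq> (0, reach 0 t)"
        using in2 b tree_diagonals_iff[of p2 p5 t'] reach by auto
      show ?thesis
        unfolding uv(2) insert_iff Diff_iff eq empty_iff tree_diagonals_iff[OF uv(1)]
          hexagon_rotation_arcs[OF rot] reach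
        using long by blast
    qed
    moreover have "?L \<subseteq> diagonals n" "?R \<subseteq> diagonals n"
      using tree_diagonals_diagonals[OF n t] tree_diagonals_diagonals[OF n t'] in2 by auto
    ultimately show ?thesis by blast
  qed
qed

text \<open>The six sides and the nine diagonals of a hexagon.\<close>

lemma hexagon_pairs:
  assumes "p0 < p1" "p1 < p2" "p2 < p3" "p3 < p4" "p4 < (p5 :: nat)"
    and "u \<in> {p0, p1, p2, p3, p4, p5}" "v \<in> {p0, p1, p2, p3, p4, p5}" "u < v"
  shows "(u, v) \<in> {(p0, p1), (p1, p2), (p2, p3), (p3, p4), (p4, p5), (p0, p5)} \<or>
    (u, v) \<in> {(p0, p2), (p0, p3), (p0, p4), (p1, p3), (p1, p4), (p1, p5), (p2, p4), (p2, p5), (p3, p5)}"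
  using assms(6,7)
  by (elim insertE emptyE) (use assms(1-5,8) in simp_all)

lemma hexagon_side_condition:
  assumes "p0 < p1" "p1 < p2" "p2 < p3" "p3 < p4" "p4 < (p5 :: nat)"
  defines "H \<equiv> {p0, p1, p2, p3, p4, p5}"
  assumes "u \<in> H" "v \<in> H" "u < v"
  shows "(\<forall>w\<in>H. w \<le> u \<or> v \<le> w) \<or> (\<forall>w\<in>H. u \<le> w \<and> w \<le> v) \<longleftrightarrow>
    (u, v) \<in> {(p0, p1), (p1, p2), (p2, p3), (p3, p4), (p4, p5), (p0, p5)}"
proof -
  note pairs = hexagon_pairs[OF assms(1-5) assms(7,8)[unfolded H_def] assms(9)]
  from pairs show ?thesis
    by (elim disjE insertE emptyE) (use assms(1-5) in \<open>simp_all add: H_def\<close>)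
qed

text \<open>If the new edge \<open>j\<close> were neither of the two diagonals, then no edge of \<open>Q2\<close> would cut the hexagon:
  the third long diagonal starts at an odd vertex, the short ones join vertices of equal parity, and
  of the two given ones, the one different from \<open>i\<close> is not in \<open>Q1\<close>, as it crosses \<open>i\<close>. So the hexagon
  would be a region of \<open>Q2\<close> with six corners.\<close>

lemma flip_in_hexagon:
  assumes n: "n \<ge> 1" and alt: "alternating_colouring n white"
    and Q1: "Q1 \<in> compatible_quadrangulations n white (fan n)"
    and Q2: "Q2 \<in> compatible_quadrangulations n white (fan n)"
    and flip: "i \<in> Q1" "j \<noteq> i" "Q2 = insert j (Q1 - {i})"
    and hex: "hexagon n p0 p1 p2 p3 p4 p5"
    and sides: "{(p0, p1), (p1, p2), (p2, p3), (p3, p4), (p4, p5), (p0, p5)} \<subseteq> arcs n Q1"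
    and i: "i = {p0, p3} \<or> i = {p2, p5}"
  shows "j = {p0, p3} \<or> j = {p2, p5}"
proof (rule ccontr)
  assume neg: "\<not> ?thesis"
  let ?H = "{p0, p1, p2, p3, p4, p5}"
  let ?S = "{(p0, p1), (p1, p2), (p2, p3), (p3, p4), (p4, p5), (p0, p5)}"
  have less: "p0 < p1" "p1 < p2" "p2 < p3" "p3 < p4" "p4 < p5" "p5 < 2 * n + 2"
    and par: "even p0" "odd p1" "even p2" "odd p3" "even p4" "odd p5"
    using hex by (auto simp: hexagon_def)
  have Q: "quadrangulation n Q1" "quadrangulation n Q2"
    and even: "\<And>u v. (u, v) \<in> arcs n Q2 \<Longrightarrow> v = Suc u \<or> even u"
    using Q1 Q2 by (auto simp: compatible_quadrangulations_iff[OF n alt])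
  have nc: "noncrossing (arcs n Q1)" and D: "Q1 \<subseteq> diagonals n"
    using Q(1) by (auto simp: quadrangulation_iff[OF n])
  have i_diag: "i \<notin> boundary_edges n" using flip(1) D by (auto simp: diagonals_def)
  have arc2: "(u, v) \<in> arcs n Q2 \<longleftrightarrow> (u, v) \<in> arcs n Q1 \<and> {u, v} \<noteq> i \<or> u < v \<and> {u, v} = j" for u v
    using flip(2) i_diag unfolding arcs_def edges_def flip(3) by auto
  have ne: "{u, v} \<noteq> i" if "(u, v) \<in> ?S" for u v
    using that less i by (auto simp: doubleton_eq_iff)
  have "(p0, p3) \<notin> arcs n Q2"
  proof
    assume "(p0, p3) \<in> arcs n Q2"
    then have *: "(p0, p3) \<in> arcs n Q1" "i = {p2, p5}" using neg i unfolding arc2 by auto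
    then have "(p2, p5) \<in> arcs n Q1" using flip(1) less by (simp add: arcs_iff[OF n])
    from noncrossingD[OF nc *(1) this] show False using less by simp
  qed
  moreover have "(p2, p5) \<notin> arcs n Q2"
  proof
    assume "(p2, p5) \<in> arcs n Q2"
    then have *: "(p2, p5) \<in> arcs n Q1" "i = {p0, p3}" using neg i unfolding arc2 by auto
    then have "(p0, p3) \<in> arcs n Q1" using flip(1) less by (simp add: arcs_iff[OF n])
    from noncrossingD[OF nc this *(1)] show False using less by simp
  qed
  moreover have "(p1, p4) \<notin> arcs n Q2" using even[of p1 p4] par less by auto
  moreover have "(u, v) \<notin> arcs n Q2" if "even u \<longleftrightarrow> even v" for u v
    using quadrangulation_arc_parity[OF n Q(2)] that by blast
  then have "(p0, p2) \<notin> arcs n Q2" "(p0, p4) \<notin> arcs n Q2" "(p1, p3) \<notin> arcs n Q2"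
    "(p1, p5) \<notin> arcs n Q2" "(p2, p4) \<notin> arcs n Q2" "(p3, p5) \<notin> arcs n Q2" using par by auto
  ultimately have nonsides: "(u, v) \<notin> arcs n Q2" if "u \<in> ?H" "v \<in> ?H" "u < v" "(u, v) \<notin> ?S" for u v
    using hexagon_pairs[OF less(1-5) that(1-3)] that(4) by (elim disjE insertE emptyE) simp_all
  have "(u, v) \<in> arcs n Q2 \<longleftrightarrow> (u, v) \<in> ?S" if "u \<in> ?H" "v \<in> ?H" "u < v" for u v
  proof (cases "(u, v) \<in> ?S")
    case True
    have "(u, v) \<in> arcs n Q1" using sides True by (rule subsetD)
    with ne[OF True] have "(u, v) \<in> arcs n Q2" unfolding arc2 by simp
    with True show ?thesis by (simp only:)
  next
    case False
    then show ?thesis using nonsides[OF that False] by (simp only:)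
  qed
  then have "?H \<in> regions n Q2"
    unfolding regions_iff
  proof (intro conjI ballI impI)
    show "?H \<subseteq> vertices n" using less by (simp add: vertices_def)
    show "3 \<le> card ?H" using less by simp
  qed (simp only: hexagon_side_condition[OF less(1-5)])
  then have "card ?H = 4" using Q(2) by (simp add: quadrangulation_def)
  then show False using less by simp
qed

text \<open>The diagonal \<open>i\<close> is the entrance, the left side or the right side of each of the two squares. Two
  different squares cannot both lie above \<open>i\<close>, because the entrance of one would cross an arc
  of the other. Hence one is the child of the other, and the two cases are those of a left and a right
  child.\<close>

lemma squares_at_diagonal:
  assumes n: "n \<ge> 1" and t: "size t = n" and i: "i \<in> tree_diagonals t"
    and FG: "F \<in> squares n (tree_diagonals t)" "G \<in> squares n (tree_diagonals t)" "F \<noteq> G" "i \<subseteq> F" "i \<subseteq> G"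
  obtains (left) p0 p1 p2 p3 p4 p5 t' where "hexagon_rotation p0 p1 p2 p3 p4 p5 0 t t'"
      "i = {p0, p3}" "F \<union> G = {p0, p1, p2, p3, p4, p5}"
  | (right) p0 p1 p2 p3 p4 p5 t' where "hexagon_rotation p0 p1 p2 p3 p4 p5 0 t' t"
      "i = {p2, p5}" "F \<union> G = {p0, p1, p2, p3, p4, p5}"
proof -
  note nc = noncrossing_tree_arcs[of 0 t]
  obtain u v where uv: "i = {u, v}" "(u, v) \<in> tree_arcs 0 t" "v \<noteq> Suc u"
    using i by (auto simp: tree_diagonals_def)
  have "u < v" using tree_arcs_bounds(2)[OF uv(2)] .
  have par: "even u" "odd v" using tree_arcs_parity[OF uv(2)] uv(3) by auto
  have position: "(\<exists>b c. (u, b, c, v) \<in> tree_quads 0 t \<and> E = {u, b, c, v}) \<or>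
      (\<exists>d. (u, v, Suc v, d) \<in> tree_quads 0 t \<and> E = {u, v, Suc v, d}) \<or>
      (\<exists>a b. (a, b, u, v) \<in> tree_quads 0 t \<and> E = {a, b, u, v})"
    if E: "E \<in> squares n (tree_diagonals t)" "i \<subseteq> E" for E
  proof -
    obtain a b c d where q: "(a, b, c, d) \<in> tree_quads 0 t" "E = {a, b, c, d}"
      using E(1) unfolding squares_tree_diagonals[OF n t] by blast
    note less = tree_quads_quad(1-6)[OF q(1) even_zero]
    have "u = a \<and> v = b \<or> u = a \<and> v = d \<or> u = c \<and> v = d"
      using E(2) uv(1) q(2) less par \<open>u < v\<close> by auto
    then show ?thesis using q less(2) by auto
  qed
  note arcs = tree_quads_quad[OF _ even_zero, of _ _ _ _ t]
  have top: "E = E'" if "(u, b, c, v) \<in> tree_quads 0 t \<and> E = {u, b, c, v}"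
    "(u, b', c', v) \<in> tree_quads 0 t \<and> E' = {u, b', c', v}" for b c b' c' E E'
    using that tree_quads_unique[OF n t] by blast
  have left_unique: "d = d'" if "(u, v, Suc v, d) \<in> tree_quads 0 t" "(u, v, Suc v, d') \<in> tree_quads 0 t" for d d'
    using arcs[OF that(1)] arcs[OF that(2)] noncrossingD[OF nc, of u d "Suc v" d']
      noncrossingD[OF nc, of u d' "Suc v" d] by (metis less_SucI linorder_neqE_nat)
  have right_unique: "a = a' \<and> b = b'" if "(a, b, u, v) \<in> tree_quads 0 t" "(a', b', u, v) \<in> tree_quads 0 t" for a b a' b'
  proof -
    have "b = b'" using arcs(2)[OF that(1)] arcs(2)[OF that(2)] by simp
    moreover have "\<not> a < a'" 
      using noncrossingD[OF nc arcs(7)[OF that(1)] arcs(10)[OF that(2)]] arcs(1,2,3)[OF that(1)] arcs(1,2,3)[OF that(2)] \<open>b = b'\<close>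
      by auto
    moreover have "\<not> a' < a" 
      using noncrossingD[OF nc arcs(7)[OF that(2)] arcs(10)[OF that(1)]] arcs(1,2,3)[OF that(1)] arcs(1,2,3)[OF that(2)] \<open>b = b'\<close>
      by auto
    ultimately show ?thesis by simp
  qed
  have not_both: False if "(u, v, Suc v, d) \<in> tree_quads 0 t" "(a, b, u, v) \<in> tree_quads 0 t" for a b d
    using noncrossingD[OF nc arcs(10)[OF that(2)] arcs(10)[OF that(1)]]
      arcs(1,2,3)[OF that(1)] arcs(1,2,3)[OF that(2)] by auto
  have child_left: thesis if top: "(u, b, c, v) \<in> tree_quads 0 t" and parent: "(u, v, Suc v, d) \<in> tree_quads 0 t"
    and un: "F \<union> G = {u, b, c, v} \<union> {u, v, Suc v, d}" for b c d
  proof -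
    obtain p1 p2 t' where rot: "hexagon_rotation u p1 p2 v (Suc v) d 0 t t'"
      using rotate_left_branch[OF parent uv(3)] by blast
    have "p1 = b \<and> p2 = c" using tree_quads_unique[OF n t top hexagon_rotation_quads(1)[OF rot]] .
    then show thesis using un by (intro left[OF rot uv(1)]) auto
  qed
  have child_right: thesis if top: "(u, b, c, v) \<in> tree_quads 0 t" and parent: "(a, b', u, v) \<in> tree_quads 0 t"
    and un: "F \<union> G = {u, b, c, v} \<union> {a, b', u, v}" for a b b' c
  proof -
    obtain p3 p4 t' where rot: "hexagon_rotation a b' u p3 p4 v 0 t' t"
      using rotate_right_branch[OF parent uv(3)] by blast
    have "p3 = b \<and> p4 = c" using tree_quads_unique[OF n t top hexagon_rotation_quads(4)[OF rot]] .
    then show thesis using un by (intro right[OF rot uv(1)]) auto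
  qed
  from position[OF FG(1,4)] position[OF FG(2,5)] show thesis
  proof (elim disjE exE conjE)
    fix b c b' c' assume "(u, b, c, v) \<in> tree_quads 0 t" "F = {u, b, c, v}"
      "(u, b', c', v) \<in> tree_quads 0 t" "G = {u, b', c', v}"
    then show thesis using top FG(3) by blast
  next
    fix b c d assume "(u, b, c, v) \<in> tree_quads 0 t" "F = {u, b, c, v}"
      "(u, v, Suc v, d) \<in> tree_quads 0 t" "G = {u, v, Suc v, d}"
    then show thesis using child_left by blast
  next
    fix b c a b' assume "(u, b, c, v) \<in> tree_quads 0 t" "F = {u, b, c, v}"
      "(a, b', u, v) \<in> tree_quads 0 t" "G = {a, b', u, v}"
    then show thesis using child_right by blast
  next
    fix d b c assume "(u, v, Suc v, d) \<in> tree_quads 0 t" "F = {u, v, Suc v, d}"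
      "(u, b, c, v) \<in> tree_quads 0 t" "G = {u, b, c, v}"
    then show thesis using child_left[of b c d] by (simp add: Un_commute)
  next
    fix d d' assume "(u, v, Suc v, d) \<in> tree_quads 0 t" "F = {u, v, Suc v, d}"
      "(u, v, Suc v, d') \<in> tree_quads 0 t" "G = {u, v, Suc v, d'}"
    then show thesis using left_unique FG(3) by blast
  next
    fix d a b assume "(u, v, Suc v, d) \<in> tree_quads 0 t" "(a, b, u, v) \<in> tree_quads 0 t"
    then show thesis using not_both by blast
  next
    fix a b' b c assume "(a, b', u, v) \<in> tree_quads 0 t" "F = {a, b', u, v}"
      "(u, b, c, v) \<in> tree_quads 0 t" "G = {u, b, c, v}"
    then show thesis using child_right[of b c a b'] by (simp add: Un_commute)
  next
    fix a b d assume "(a, b, u, v) \<in> tree_quads 0 t" "(u, v, Suc v, d) \<in> tree_quads 0 t"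
    then show thesis using not_both by blast
  next
    fix a b a' b' assume "(a, b, u, v) \<in> tree_quads 0 t" "F = {a, b, u, v}"
      "(a', b', u, v) \<in> tree_quads 0 t" "G = {a', b', u, v}"
    then show thesis using right_unique FG(3) by blast
  qed
qed

lemma oriented_flip_passes:
  "oriented_flip n white (fan n) i j Q1 Q2 \<longleftrightarrow> flip n white (fan n) i j Q1 Q2 \<and>
    (\<exists>F\<in>squares n Q1. \<exists>G\<in>squares n Q1. F \<noteq> G \<and> i \<subseteq> F \<and> i \<subseteq> G \<and>
       long_edge_passes n white (F \<union> G) i j)"
  unfolding oriented_flip_def long_edge_passes_def ..

text \<open>The left branches are the diagonals \<open>(p0, p3)\<close>, for which the flip is the rotation of the hexagon.
  A flip starting from a right branch would have to lead from \<open>(p2, p5)\<close> back to \<open>(p0, p3)\<close>, and the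
  long edges pass through the hexagon the other way.\<close>

lemma oriented_flip_iff:
  assumes n: "n \<ge> 1" and alt: "alternating_colouring n white" and t: "size t = n"
  shows "oriented_flip n white (fan n) i j (tree_diagonals t) Q2 \<longleftrightarrow>
    (\<exists>p0 p1 p2 p3 p4 p5 t'. hexagon_rotation p0 p1 p2 p3 p4 p5 0 t t' \<and>
       i = {p0, p3} \<and> j = {p2, p5} \<and> Q2 = tree_diagonals t')"
proof
  let ?D = "tree_diagonals t"
  assume "oriented_flip n white (fan n) i j ?D Q2"
  then obtain F G where Q: "?D \<in> compatible_quadrangulations n white (fan n)"
      "Q2 \<in> compatible_quadrangulations n white (fan n)"
    and flip: "i \<in> ?D" "j \<noteq> i" "Q2 = insert j (?D - {i})"
    and FG: "F \<in> squares n ?D" "G \<in> squares n ?D" "F \<noteq> G" "i \<subseteq> F" "i \<subseteq> G"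
    and passes: "long_edge_passes n white (F \<union> G) i j"
    unfolding oriented_flip_passes flip_def by blast
  have target: "j = {p0, p3} \<or> j = {p2, p5}"
    if "hexagon n p0 p1 p2 p3 p4 p5" "i = {p0, p3} \<or> i = {p2, p5}"
      "{(p0, p1), (p1, p2), (p2, p3), (p3, p4), (p4, p5), (p0, p5)} \<subseteq> tree_arcs 0 t"
    for p0 p1 p2 p3 p4 p5
    using flip_in_hexagon[OF n alt Q flip that(1) _ that(2)] that(3) arcs_tree_diagonals[OF n t] by simp
  show "\<exists>p0 p1 p2 p3 p4 p5 t'. hexagon_rotation p0 p1 p2 p3 p4 p5 0 t t' \<and>
       i = {p0, p3} \<and> j = {p2, p5} \<and> Q2 = tree_diagonals t'"
    using n t flip(1) FG
  proof (cases rule: squares_at_diagonal)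
    case (left p0 p1 p2 p3 p4 p5 t')
    note q = hexagon_rotation_quads(1,2)[OF left(1), THEN tree_quads_quad(7), OF even_zero]
      hexagon_rotation_quads(1,2)[OF left(1), THEN tree_quads_quad(8), OF even_zero]
      hexagon_rotation_quads(1,2)[OF left(1), THEN tree_quads_quad(9), OF even_zero]
      hexagon_rotation_quads(1,2)[OF left(1), THEN tree_quads_quad(10), OF even_zero]
    have "j = {p0, p3} \<or> j = {p2, p5}"
      by (rule target[OF hexagon_rotation_hexagon[OF left(1) t]]) (use left q in auto)
    then have "j = {p2, p5}" using flip(2) left(2) by blast
    moreover have "Q2 = tree_diagonals t'"
      using flip(3) hexagon_rotation_diagonals(1)[OF n t left(1)] left(2) \<open>j = {p2, p5}\<close> by simp
    ultimately show ?thesis using left by blast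
  next
    case (right p0 p1 p2 p3 p4 p5 t')
    have "size t' = n" using hexagon_rotation_size[OF right(1)] t by simp
    note hex = hexagon_rotation_hexagon[OF right(1) this]
    note q = hexagon_rotation_quads(3,4)[OF right(1), THEN tree_quads_quad(7), OF even_zero]
      hexagon_rotation_quads(3,4)[OF right(1), THEN tree_quads_quad(8), OF even_zero]
      hexagon_rotation_quads(3,4)[OF right(1), THEN tree_quads_quad(9), OF even_zero]
      hexagon_rotation_quads(3,4)[OF right(1), THEN tree_quads_quad(10), OF even_zero]
    have "j = {p0, p3} \<or> j = {p2, p5}"
      by (rule target[OF hex]) (use right q in auto)
    then have "j = {p0, p3}" using flip(2) right(2) by blast
    then show ?thesis
      using passes long_edge_passes_hexagon(2)[OF alt hex] right(2,3) by simp
  qed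
next
  let ?D = "tree_diagonals t"
  assume "\<exists>p0 p1 p2 p3 p4 p5 t'. hexagon_rotation p0 p1 p2 p3 p4 p5 0 t t' \<and>
       i = {p0, p3} \<and> j = {p2, p5} \<and> Q2 = tree_diagonals t'"
  then obtain p0 p1 p2 p3 p4 p5 t' where rot: "hexagon_rotation p0 p1 p2 p3 p4 p5 0 t t'"
    and ij: "i = {p0, p3}" "j = {p2, p5}" and Q2: "Q2 = tree_diagonals t'" by blast
  note less = hexagon_rotation_bounds[OF rot]
  have "size t' = n" using hexagon_rotation_size[OF rot] t by simp
  have "j \<noteq> i" using ij less by (auto simp: doubleton_eq_iff)
  then have flip: "flip n white (fan n) i j ?D Q2"
    using tree_diagonals_compatible[OF n alt t] tree_diagonals_compatible[OF n alt \<open>size t' = n\<close>]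
      hexagon_rotation_diagonals[OF n t rot] ij Q2 by (simp add: flip_def)
  let ?F = "{p0, p1, p2, p3}" and ?G = "{p0, p3, p4, p5}"
  have squares: "?F \<in> squares n ?D" "?G \<in> squares n ?D"
    unfolding squares_tree_diagonals[OF n t] using hexagon_rotation_quads(1,2)[OF rot] by blast+
  have "?F \<noteq> ?G" using less by (auto simp: set_eq_iff)
  moreover have "i \<subseteq> ?F" "i \<subseteq> ?G" using ij by auto
  moreover have "?F \<union> ?G = {p0, p1, p2, p3, p4, p5}" by auto
  then have "long_edge_passes n white (?F \<union> ?G) i j"
    using long_edge_passes_hexagon(1)[OF alt hexagon_rotation_hexagon[OF rot t]] ij by simp
  ultimately show "oriented_flip n white (fan n) i j ?D Q2"
    unfolding oriented_flip_passes by (intro conjI flip bexI[OF _ squares(1)] bexI[OF _ squares(2)])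
qed

theorem proposition2p1:
  fixes n :: nat and white :: "nat \<Rightarrow> bool"
  assumes "n \<ge> 1" and "alternating_colouring n white"
  shows "bij_betw (\<lambda>Q. ternary_shape (dual_tree n Q))
           (compatible_quadrangulations n white (fan n))
           {t :: unit ttree. nodes t = n \<and> no_middle t} \<and>
         bij_betw (\<lambda>Q. binary_shape (binary_dual_tree n Q))
           (compatible_quadrangulations n white (fan n))
           {t :: unit tree. size t = n} \<and>
         (\<forall>Q1\<in>compatible_quadrangulations n white (fan n).
          \<forall>Q2\<in>compatible_quadrangulations n white (fan n).
            (\<exists>i j. oriented_flip n white (fan n) i j Q1 Q2) \<longleftrightarrow>
            rotation (binary_shape (binary_dual_tree n Q1)) (binary_shape (binary_dual_tree n Q2))) \<and>
         (\<forall>Q1\<in>compatible_quadrangulations n white (fan n).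
          \<forall>Q2\<in>compatible_quadrangulations n white (fan n). \<forall>i.
            (\<exists>j. oriented_flip n white (fan n) i j Q1 Q2) \<longleftrightarrow>
            (\<exists>v\<in>squares n Q1. i = left_side v \<and>
               (\<exists>t. rotation_at v (binary_dual_tree n Q1) t \<and>
                  binary_shape t = binary_shape (binary_dual_tree n Q2)))) \<and>
         (\<forall>Q\<in>compatible_quadrangulations n white (fan n). \<forall>i\<in>Q.
            (in_flip n white (fan n) Q i \<longleftrightarrow> right_branch n Q i) \<and>
            (out_flip n white (fan n) Q i \<longleftrightarrow> left_branch n Q i))"
proof -
  note n = assms(1) and alt = assms(2)
  let ?C = "compatible_quadrangulations n white (fan n)"
  let ?T = "{t :: unit tree. size t = n}"
  have image: "?C = tree_diagonals ` ?T" by (rule compatible_eq_image[OF assms])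
  have binary: "binary_shape (binary_dual_tree n (tree_diagonals t)) = t" if "t \<in> ?T" for t
    using that by (simp add: dual_tree_tree_diagonals(2)[OF n] binary_shape_square_tree)
  have ternary: "ternary_shape (dual_tree n Q) = to_ternary (binary_shape (binary_dual_tree n Q))"
    if mem: "Q \<in> ?C" for Q
  proof -
    obtain t where "size t = n" "Q = tree_diagonals t" using mem unfolding image by blast
    then show ?thesis
      by (simp only: dual_tree_tree_diagonals[OF n] binary_shape_square_tree ternary_shape_square_ttree)
  qed
  have shape: "binary_shape (binary_dual_tree n Q) \<in> ?T"
    "tree_diagonals (binary_shape (binary_dual_tree n Q)) = Q" if mem: "Q \<in> ?C" for Q
  proof -
    obtain t where t: "t \<in> ?T" "Q = tree_diagonals t" using mem unfolding image by blast
    show "binary_shape (binary_dual_tree n Q) \<in> ?T"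
      and "tree_diagonals (binary_shape (binary_dual_tree n Q)) = Q"
      unfolding t(2) binary[OF t(1)] by (rule t(1), rule refl)
  qed
  have bij: "bij_betw (\<lambda>Q. binary_shape (binary_dual_tree n Q)) ?C ?T"
  proof (rule bij_betwI[where g = tree_diagonals])
    show "tree_diagonals \<in> ?T \<rightarrow> ?C" unfolding image by (intro Pi_I imageI)
  qed (rule Pi_I, (rule shape binary; assumption)+)
  have 0: "bij_betw (\<lambda>Q. to_ternary (binary_shape (binary_dual_tree n Q))) ?C {t. nodes t = n \<and> no_middle t}"
    using bij_betw_trans[OF bij to_ternary_bij] by (simp add: comp_def)
  have 1: "bij_betw (\<lambda>Q. ternary_shape (dual_tree n Q)) ?C {t. nodes t = n \<and> no_middle t}"
    by (rule bij_betw_cong[THEN iffD1, OF _ 0]) (rule ternary[symmetric])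
  have 4: "(\<exists>j. oriented_flip n white (fan n) i j Q1 Q2) \<longleftrightarrow>
      (\<exists>v\<in>squares n Q1. i = left_side v \<and> (\<exists>t. rotation_at v (binary_dual_tree n Q1) t \<and>
         binary_shape t = binary_shape (binary_dual_tree n Q2)))"
    if mem: "Q1 \<in> ?C" "Q2 \<in> ?C" for Q1 Q2 i
  proof -
    obtain t1 t2 where t: "size t1 = n" "size t2 = n" and Q: "Q1 = tree_diagonals t1" "Q2 = tree_diagonals t2"
      using mem unfolding image by blast
    have shape: "binary_dual_tree n Q1 = square_tree 0 t1" "binary_shape (binary_dual_tree n Q2) = t2"
      using t by (simp_all add: Q dual_tree_tree_diagonals(2)[OF n] binary_shape_square_tree)
    show ?thesis unfolding shape
    proof
      assume "\<exists>j. oriented_flip n white (fan n) i j Q1 Q2"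
      then obtain p0 p1 p2 p3 p4 p5 t' where rot: "hexagon_rotation p0 p1 p2 p3 p4 p5 0 t1 t'"
        and i: "i = {p0, p3}" and "tree_diagonals t2 = tree_diagonals t'"
        unfolding Q oriented_flip_iff[OF assms t(1)] by blast
      then have "t' = t2" using tree_diagonals_inj[OF n _ t(2)] hexagon_rotation_size[OF rot] t by metis
      let ?v = "{p0, p3, p4, p5}"
      have "?v \<in> squares n Q1" unfolding Q squares_tree_diagonals[OF n t(1)]
        using hexagon_rotation_quads(2)[OF rot] by blast
      moreover have "i = left_side ?v"
        using hexagon_rotation_bounds[OF rot] i by (simp add: square_side_simps)
      moreover have "\<exists>T. rotation_at ?v (square_tree 0 t1) T \<and> binary_shape T = t2"
        using hexagon_rotation_imp_rotation_at[OF rot] \<open>t' = t2\<close> by simp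
      ultimately show "\<exists>v\<in>squares n Q1. i = left_side v \<and>
          (\<exists>T. rotation_at v (square_tree 0 t1) T \<and> binary_shape T = t2)" by blast
    next
      assume "\<exists>v\<in>squares n Q1. i = left_side v \<and>
          (\<exists>T. rotation_at v (square_tree 0 t1) T \<and> binary_shape T = t2)"
      then obtain v T where v: "i = left_side v" "rotation_at v (square_tree 0 t1) T" "binary_shape T = t2"
        by blast
      obtain p0 p1 p2 p3 p4 p5 where rot: "hexagon_rotation p0 p1 p2 p3 p4 p5 0 t1 t2"
        and "v = {p0, p3, p4, p5}"
        using rotation_at_imp_hexagon_rotation[OF v(2)] v(3) by blast
      then have "i = {p0, p3}" using hexagon_rotation_bounds[OF rot] v(1) by (simp add: square_side_simps)
      then show "\<exists>j. oriented_flip n white (fan n) i j Q1 Q2"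
        unfolding Q oriented_flip_iff[OF assms t(1)] using rot by blast
    qed
  qed
  have 3: "(\<exists>i j. oriented_flip n white (fan n) i j Q1 Q2) \<longleftrightarrow>
      rotation (binary_shape (binary_dual_tree n Q1)) (binary_shape (binary_dual_tree n Q2))"
    if mem: "Q1 \<in> ?C" "Q2 \<in> ?C" for Q1 Q2
  proof -
    obtain t1 t2 where t: "size t1 = n" "size t2 = n" and Q: "Q1 = tree_diagonals t1" "Q2 = tree_diagonals t2"
      using mem unfolding image by blast
    have same: "tree_diagonals t2 = tree_diagonals t' \<longleftrightarrow> t' = t2"
      if "hexagon_rotation p0 p1 p2 p3 p4 p5 0 t1 t'" for p0 p1 p2 p3 p4 p5 t'
      using tree_diagonals_inj[OF n _ t(2)] hexagon_rotation_size[OF that] t by metis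
    have "(\<exists>i j. oriented_flip n white (fan n) i j Q1 Q2) \<longleftrightarrow>
        (\<exists>p0 p1 p2 p3 p4 p5. hexagon_rotation p0 p1 p2 p3 p4 p5 0 t1 t2)"
      unfolding Q oriented_flip_iff[OF assms t(1)] using same by blast
    also have "\<dots> \<longleftrightarrow> rotation t1 t2" by (rule rotation_iff_hexagon_rotation[symmetric])
    finally show ?thesis using t by (simp add: Q binary)
  qed
  have 5: "in_flip n white (fan n) Q i \<longleftrightarrow> right_branch n Q i"
    and 6: "out_flip n white (fan n) Q i \<longleftrightarrow> left_branch n Q i"
    if mem: "Q \<in> ?C" "i \<in> Q" for Q i
  proof -
    obtain t where t: "size t = n" and Q: "Q = tree_diagonals t"
      using mem unfolding image by blast
    show "in_flip n white (fan n) Q i \<longleftrightarrow> right_branch n Q i"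
    proof
      assume "in_flip n white (fan n) Q i"
      then obtain j Q'' where flip: "oriented_flip n white (fan n) j i Q'' Q" by (auto simp: in_flip_def)
      then have "Q'' \<in> ?C" by (simp add: oriented_flip_def flip_def)
      then obtain t'' where t'': "size t'' = n" "Q'' = tree_diagonals t''" unfolding image by blast
      then obtain p0 p1 p2 p3 p4 p5 t' where rot: "hexagon_rotation p0 p1 p2 p3 p4 p5 0 t'' t'"
        and i: "i = {p2, p5}" and eq: "Q = tree_diagonals t'"
        using flip unfolding t''(2) oriented_flip_iff[OF assms t''(1)] by blast
      have "size t' = n" using hexagon_rotation_size[OF rot] t'' by simp
      have "{p0, p1, p2, p5} \<in> squares n Q" unfolding eq squares_tree_diagonals[OF n \<open>size t' = n\<close>]
        using hexagon_rotation_quads(3)[OF rot] by blast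
      moreover have "i = right_side {p0, p1, p2, p5}"
        using hexagon_rotation_bounds[OF rot] i by (simp add: square_side_simps)
      ultimately show "right_branch n Q i" using mem(2) by (auto simp: right_branch_def)
    next
      assume "right_branch n Q i"
      then obtain F where F: "F \<in> squares n (tree_diagonals t)" "i = right_side F"
        unfolding right_branch_def Q by blast
      then obtain a b c d where q: "(a, b, c, d) \<in> tree_quads 0 t" and i: "i = right_side {a, b, c, d}"
        unfolding squares_tree_diagonals[OF n t] by blast
      note less = tree_quads_quad(1-3)[OF q even_zero]
      have i: "i = {c, d}" using i less by (simp add: square_side_simps)
      have "d \<noteq> Suc c" using mem(2) less(3) unfolding Q i tree_diagonals_iff[OF less(3)] by simp
      then obtain p3 p4 t' where rot: "hexagon_rotation a b c p3 p4 d 0 t' t"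
        using rotate_right_branch[OF q] by blast
      have "size t' = n" using hexagon_rotation_size[OF rot] t by simp
      have "oriented_flip n white (fan n) {a, p3} {c, d} (tree_diagonals t') (tree_diagonals t)"
        unfolding oriented_flip_iff[OF assms \<open>size t' = n\<close>]
        by (intro exI conjI, rule rot) (rule refl)+
      then show "in_flip n white (fan n) Q i" unfolding in_flip_def Q i by blast
    qed
    show "out_flip n white (fan n) Q i \<longleftrightarrow> left_branch n Q i"
    proof
      assume "out_flip n white (fan n) Q i"
      then obtain p0 p1 p2 p3 p4 p5 t' where rot: "hexagon_rotation p0 p1 p2 p3 p4 p5 0 t t'"
        and i: "i = {p0, p3}"
        unfolding out_flip_def Q oriented_flip_iff[OF assms t] by blast
      have "{p0, p3, p4, p5} \<in> squares n Q" unfolding Q squares_tree_diagonals[OF n t]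
        using hexagon_rotation_quads(2)[OF rot] by blast
      moreover have "i = left_side {p0, p3, p4, p5}"
        using hexagon_rotation_bounds[OF rot] i by (simp add: square_side_simps)
      ultimately show "left_branch n Q i" using mem(2) by (auto simp: left_branch_def)
    next
      assume "left_branch n Q i"
      then obtain F where F: "F \<in> squares n (tree_diagonals t)" "i = left_side F"
        unfolding left_branch_def Q by blast
      then obtain a b c d where q: "(a, b, c, d) \<in> tree_quads 0 t" and i: "i = left_side {a, b, c, d}"
        unfolding squares_tree_diagonals[OF n t] by blast
      note less = tree_quads_quad(1-3)[OF q even_zero]
      have i: "i = {a, b}" using i less by (simp add: square_side_simps)
      have "b \<noteq> Suc a" using mem(2) unfolding Q i tree_diagonals_iff[OF less(1)] by simp
      then obtain p1 p2 t' where "hexagon_rotation a p1 p2 b c d 0 t t'"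
        using rotate_left_branch[OF q] by blast
      then show "out_flip n white (fan n) Q i"
        unfolding out_flip_def Q oriented_flip_iff[OF assms t] using i by blast
    qed
  qed
  show ?thesis by (intro conjI ballI allI; (rule 1 bij 3 4 5 6; assumption))
qed


end
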